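(* Let $G$ be a locally compact group, $H$ a compact subgroup of $G$, and $\xi:H\to\mathbb{T}$ a character of $H$. Let $1<p,q<\infty$ with $p^{-1}+q^{-1}=1$. Then $L^q_\xi(G,H)$ is isometrically isomorphic to the dual space $L^p_\xi(G,H)^*$.
   Context: $\lambda_G$ is a fixed left Haar measure on $G$, and $L^r(G)=L^r(G,\lambda_G)$ (complex valued). $\mathbb{T}=\{z\in\mathbb{C}:|z|=1\}$; a character of $H$ is a continuous group homomorphism $H\to\mathbb{T}$. $\mathrm{q}:G\to G/H$, $\mathrm{q}(x)=xH$, is the canonical map, and $\mathcal{C}(G)$ is the space of continuous complex functions on $G$. $\mathcal{C}_c(G|H):=\{\psi\in\mathcal{C}(G): \mathrm{q}(\mathrm{supp}(\psi))\text{ is compact in }G/H\}$, and $M_\xi(G,H):=\{\psi\in\mathcal{C}_c(G|H): \psi(xh)=\xi(h)\psi(x)\text{ for all }x\in G,\ h\in H\}$. (Since $H$ is compact, $M_\xi(G,H)\subseteq\mathcal{C}_c(G)$.) For $1\le r<\infty$, $L^r_\xi(G,H)$ is the Banach completion of $M_\xi(G,H)$ with respect to $\|\cdot\|_{L^r(G)}$, viewed as a closed subspace of $L^r(G)$ (the closure of $M_\xi(G,H)$ in $L^r(G)$). Convention: the paper identifies $L^q(G)$ isometrically with $L^p(G)^*$ through $g\mapsto\Lambda_g$, $\Lambda_g(f)=\int_G f\overline{g}\,\mathrm{d}\lambda_G$, which is conjugate-linear in $g$; "isometrically isomorphic" between such a function space and a dual space is understood with respect to identifications of this kind. *)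

theory Defs
  imports "HOL-Analysis.Analysis" "HOL-Algebra.Left_Coset"
begin

section \<open>Topological groups, characters and Haar measure\<close>

locale topological_group = group G for G :: "('a, 'b) monoid_scheme" (structure) +
  fixes T :: "'a topology"
  assumes topspace_eq_carrier: "topspace T = carrier G"
    and continuous_mult: "continuous_map (prod_topology T T) T (\<lambda>(x, y). x \<otimes> y)"
    and continuous_inv: "continuous_map T T (\<lambda>x. inv x)"

text \<open>As usual, local compactness of a group includes the Hausdorff property.\<close>

locale locally_compact_group = topological_group +
  assumes locally_compact: "locally_compact_space T"
    and Hausdorff: "Hausdorff_space T"

definition character_on :: "('a, 'b) monoid_scheme \<Rightarrow> 'a topology \<Rightarrow> 'a set \<Rightarrow> ('a \<Rightarrow> complex) \<Rightarrow> bool"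
  where "character_on G T H \<xi> \<longleftrightarrow>
    continuous_map (subtopology T H) euclidean \<xi> \<and>
    (\<forall>h\<in>H. cmod (\<xi> h) = 1) \<and>
    (\<forall>h\<in>H. \<forall>k\<in>H. \<xi> (h \<otimes>\<^bsub>G\<^esub> k) = \<xi> h * \<xi> k)"

text \<open>A left Haar measure is a nonzero left invariant Radon measure on the Borel sets.\<close>

definition left_haar_measure :: "('a, 'b) monoid_scheme \<Rightarrow> 'a topology \<Rightarrow> 'a measure \<Rightarrow> bool"
  where "left_haar_measure G T M \<longleftrightarrow>
    space M = carrier G \<and>
    sets M = sigma_sets (carrier G) {U. openin T U} \<and>
    emeasure M (space M) \<noteq> 0 \<and>
    (\<forall>x\<in>carrier G. \<forall>A\<in>sets M. emeasure M (x <#\<^bsub>G\<^esub> A) = emeasure M A) \<and>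
    (\<forall>K. compactin T K \<longrightarrow> emeasure M K < \<infinity>) \<and>
    (\<forall>A\<in>sets M. emeasure M A = (INF U\<in>{U. openin T U \<and> A \<subseteq> U}. emeasure M U)) \<and>
    (\<forall>U. openin T U \<longrightarrow> emeasure M U = (SUP K\<in>{K. compactin T K \<and> K \<subseteq> U}. emeasure M K))"

definition coset_topology :: "('a, 'b) monoid_scheme \<Rightarrow> 'a topology \<Rightarrow> 'a set \<Rightarrow> 'a set topology"
  where "coset_topology G T H =
    topology (\<lambda>U. U \<subseteq> lcosets\<^bsub>G\<^esub> H \<and> openin T {x \<in> carrier G. x <#\<^bsub>G\<^esub> H \<in> U})"

lemma openin_coset_topology:
  "openin (coset_topology G T H) U \<longleftrightarrow>
    U \<subseteq> lcosets\<^bsub>G\<^esub> H \<and> openin T {x \<in> carrier G. x <#\<^bsub>G\<^esub> H \<in> U}"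
proof -
  have "istopology (\<lambda>U. U \<subseteq> lcosets\<^bsub>G\<^esub> H \<and> openin T {x \<in> carrier G. x <#\<^bsub>G\<^esub> H \<in> U})"
    unfolding istopology_def
  proof (rule conjI; intro allI impI)
    fix S U
    assume "S \<subseteq> lcosets\<^bsub>G\<^esub> H \<and> openin T {x \<in> carrier G. x <#\<^bsub>G\<^esub> H \<in> S}"
      and "U \<subseteq> lcosets\<^bsub>G\<^esub> H \<and> openin T {x \<in> carrier G. x <#\<^bsub>G\<^esub> H \<in> U}"
    moreover have "{x \<in> carrier G. x <#\<^bsub>G\<^esub> H \<in> S \<inter> U} =
        {x \<in> carrier G. x <#\<^bsub>G\<^esub> H \<in> S} \<inter> {x \<in> carrier G. x <#\<^bsub>G\<^esub> H \<in> U}" by blast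
    ultimately show "S \<inter> U \<subseteq> lcosets\<^bsub>G\<^esub> H \<and> openin T {x \<in> carrier G. x <#\<^bsub>G\<^esub> H \<in> S \<inter> U}"
      by auto
  next
    fix \<K>
    assume *: "\<forall>K\<in>\<K>. K \<subseteq> lcosets\<^bsub>G\<^esub> H \<and> openin T {x \<in> carrier G. x <#\<^bsub>G\<^esub> H \<in> K}"
    have "{x \<in> carrier G. x <#\<^bsub>G\<^esub> H \<in> \<Union>\<K>} = (\<Union>K\<in>\<K>. {x \<in> carrier G. x <#\<^bsub>G\<^esub> H \<in> K})" by blast
    with * show "\<Union>\<K> \<subseteq> lcosets\<^bsub>G\<^esub> H \<and> openin T {x \<in> carrier G. x <#\<^bsub>G\<^esub> H \<in> \<Union>\<K>}"
      by auto
  qed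
  then show ?thesis by (simp add: coset_topology_def)
qed

lemma (in topological_group) quotient_map_coset_topology:
  "quotient_map T (coset_topology G T H) (\<lambda>x. x <# H)"
proof -
  have "topspace (coset_topology G T H) = lcosets H"
  proof
    show "topspace (coset_topology G T H) \<subseteq> lcosets H"
      unfolding topspace_def by (auto simp: openin_coset_topology)
    have "{x \<in> carrier G. x <# H \<in> lcosets H} = topspace T"
      by (auto simp: LCOSETS_def topspace_eq_carrier)
    then have "openin (coset_topology G T H) (lcosets H)"
      by (simp add: openin_coset_topology)
    then show "lcosets H \<subseteq> topspace (coset_topology G T H)"
      by (rule openin_subset)
  qed
  then show ?thesis
    by (auto simp: quotient_map_def openin_coset_topology topspace_eq_carrier LCOSETS_def)
qed


section \<open>Complex normed spaces with explicit carriers, and their duals\<close>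

record 'v complex_normed = "'v partial_object" +
  vadd :: "'v \<Rightarrow> 'v \<Rightarrow> 'v"
  vscale :: "complex \<Rightarrow> 'v \<Rightarrow> 'v"
  vnorm :: "'v \<Rightarrow> real"

text \<open>The restriction to \<open>carrier X\<close> matters because \<open>vnorm\<close> is meaningless off the carrier
  (the Bochner integral of a non-integrable function is \<open>0\<close>).\<close>

definition vclosure :: "'v complex_normed \<Rightarrow> 'v set \<Rightarrow> 'v set"
  where "vclosure X S =
    {x \<in> carrier X. \<forall>\<epsilon>>0. \<exists>s \<in> S \<inter> carrier X. vnorm X (vadd X x (vscale X (-1) s)) < \<epsilon>}"

text \<open>Functionals are extensional, so that they are determined by their values on the space.\<close>

definition dual_space :: "'v complex_normed \<Rightarrow> ('v \<Rightarrow> complex) complex_normed"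
  where "dual_space X =
    \<lparr> carrier = {\<phi> \<in> extensional (carrier X).
        (\<forall>x\<in>carrier X. \<forall>y\<in>carrier X. \<phi> (vadd X x y) = \<phi> x + \<phi> y) \<and>
        (\<forall>c. \<forall>x\<in>carrier X. \<phi> (vscale X c x) = c * \<phi> x) \<and>
        (\<exists>C. \<forall>x\<in>carrier X. cmod (\<phi> x) \<le> C * vnorm X x)},
      vadd = (\<lambda>\<phi> \<psi>. \<lambda>x\<in>carrier X. \<phi> x + \<psi> x),
      vscale = (\<lambda>c \<phi>. \<lambda>x\<in>carrier X. c * \<phi> x),
      vnorm = (\<lambda>\<phi>. SUP x\<in>{x \<in> carrier X. vnorm X x \<le> 1}. cmod (\<phi> x)) \<rparr>"

definition conj_isometric_iso :: "'v complex_normed \<Rightarrow> 'w complex_normed \<Rightarrow> ('v \<Rightarrow> 'w) \<Rightarrow> bool"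
  where "conj_isometric_iso X Y \<Phi> \<longleftrightarrow>
    bij_betw \<Phi> (carrier X) (carrier Y) \<and>
    (\<forall>x\<in>carrier X. \<forall>y\<in>carrier X. \<Phi> (vadd X x y) = vadd Y (\<Phi> x) (\<Phi> y)) \<and>
    (\<forall>c. \<forall>x\<in>carrier X. \<Phi> (vscale X c x) = vscale Y (cnj c) (\<Phi> x)) \<and>
    (\<forall>x\<in>carrier X. vnorm Y (\<Phi> x) = vnorm X x)"


section \<open>Lebesgue spaces of classes of functions\<close>

definition Lp_functions :: "'a measure \<Rightarrow> real \<Rightarrow> ('a \<Rightarrow> complex) set"
  where "Lp_functions M r =
    {f \<in> borel_measurable M. integrable M (\<lambda>x. cmod (f x) powr r)}"

definition ae_class :: "'a measure \<Rightarrow> ('a \<Rightarrow> complex) \<Rightarrow> ('a \<Rightarrow> complex) set"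
  where "ae_class M f = {g \<in> borel_measurable M. AE x in M. g x = f x}"

definition rep :: "('a \<Rightarrow> complex) set \<Rightarrow> 'a \<Rightarrow> complex"
  where "rep A = (SOME f. f \<in> A)"

text \<open>The operations are defined through representatives; they do not depend on the choice,
  see the lemmas below.\<close>

definition Lp_space :: "'a measure \<Rightarrow> real \<Rightarrow> ('a \<Rightarrow> complex) set complex_normed"
  where "Lp_space M r =
    \<lparr> carrier = ae_class M ` Lp_functions M r,
      vadd = (\<lambda>A B. ae_class M (\<lambda>x. rep A x + rep B x)),
      vscale = (\<lambda>c A. ae_class M (\<lambda>x. c * rep A x)),
      vnorm = (\<lambda>A. (LINT x|M. cmod (rep A x) powr r) powr (1 / r)) \<rparr>"

definition Lp_pairing :: "'a measure \<Rightarrow> ('a \<Rightarrow> complex) set \<Rightarrow> ('a \<Rightarrow> complex) set \<Rightarrow> complex"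
  where "Lp_pairing M F g = (LINT x|M. rep F x * cnj (rep g x))"

lemma rep_ae_class:
  assumes "f \<in> borel_measurable M"
  shows "rep (ae_class M f) \<in> borel_measurable M" "AE x in M. rep (ae_class M f) x = f x"
proof -
  have "f \<in> ae_class M f" using assms by (simp add: ae_class_def)
  then have "rep (ae_class M f) \<in> ae_class M f" unfolding rep_def
    by (rule someI[where P = "\<lambda>g. g \<in> ae_class M f"])
  then show "rep (ae_class M f) \<in> borel_measurable M" "AE x in M. rep (ae_class M f) x = f x"
    by (auto simp: ae_class_def)
qed

lemma ae_class_cong:
  assumes "AE x in M. f x = g x"
  shows "ae_class M f = ae_class M g"
  using assms by (auto simp: ae_class_def elim!: eventually_elim2)

lemma vadd_Lp_space:
  assumes "f \<in> borel_measurable M" "g \<in> borel_measurable M"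
  shows "vadd (Lp_space M r) (ae_class M f) (ae_class M g) = ae_class M (\<lambda>x. f x + g x)"
  using rep_ae_class(2)[OF assms(1)] rep_ae_class(2)[OF assms(2)]
  by (auto simp: Lp_space_def intro!: ae_class_cong elim!: eventually_elim2)

lemma vscale_Lp_space:
  assumes "f \<in> borel_measurable M"
  shows "vscale (Lp_space M r) c (ae_class M f) = ae_class M (\<lambda>x. c * f x)"
  using rep_ae_class(2)[OF assms]
  by (auto simp: Lp_space_def intro!: ae_class_cong elim!: eventually_mono)

lemma vnorm_Lp_space:
  assumes [measurable]: "f \<in> borel_measurable M"
  shows "vnorm (Lp_space M r) (ae_class M f) = (LINT x|M. cmod (f x) powr r) powr (1 / r)"
proof -
  note [measurable] = rep_ae_class(1)[OF assms]
  have "(LINT x|M. cmod (rep (ae_class M f) x) powr r) = (LINT x|M. cmod (f x) powr r)"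
    using rep_ae_class(2)[OF assms] by (intro integral_cong_AE) (auto elim!: eventually_mono)
  then show ?thesis by (simp add: Lp_space_def)
qed

lemma Lp_pairing_ae_class:
  assumes [measurable]: "f \<in> borel_measurable M" "g \<in> borel_measurable M"
  shows "Lp_pairing M (ae_class M f) (ae_class M g) = (LINT x|M. f x * cnj (g x))"
proof -
  note [measurable] = rep_ae_class(1)[OF assms(1)] rep_ae_class(1)[OF assms(2)]
  have [measurable]: "cnj \<in> borel_measurable borel"
    by (intro borel_measurable_continuous_onI continuous_intros)
  show ?thesis
    unfolding Lp_pairing_def
  proof (rule integral_cong_AE)
    show "AE x in M. rep (ae_class M f) x * cnj (rep (ae_class M g) x) = f x * cnj (g x)"
      using rep_ae_class(2)[OF assms(1)] rep_ae_class(2)[OF assms(2)] by eventually_elim simp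
  qed measurable
qed


section \<open>Covariant functions\<close>

text \<open>The values of functions outside \<open>carrier G\<close> are irrelevant here: they do not
  affect the a.e. classes formed below.\<close>

definition support_on :: "'a topology \<Rightarrow> ('a \<Rightarrow> complex) \<Rightarrow> 'a set"
  where "support_on T \<psi> = T closure_of {x \<in> topspace T. \<psi> x \<noteq> 0}"

text \<open>\<open>C_c_mod\<close>, \<open>M_cov\<close> and \<open>L_cov\<close> are the spaces usually written $\mathcal{C}_c(G|H)$,
  $M_\xi(G,H)$ and $L^r_\xi(G,H)$.\<close>

definition C_c_mod :: "('a, 'b) monoid_scheme \<Rightarrow> 'a topology \<Rightarrow> 'a set \<Rightarrow> ('a \<Rightarrow> complex) set"
  where "C_c_mod G T H =
    {\<psi>. continuous_map T euclidean \<psi> \<and>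
      compactin (coset_topology G T H) ((\<lambda>x. x <#\<^bsub>G\<^esub> H) ` support_on T \<psi>)}"

definition M_cov :: "('a, 'b) monoid_scheme \<Rightarrow> 'a topology \<Rightarrow> 'a set \<Rightarrow> ('a \<Rightarrow> complex) \<Rightarrow> ('a \<Rightarrow> complex) set"
  where "M_cov G T H \<xi> =
    {\<psi> \<in> C_c_mod G T H. \<forall>x\<in>carrier G. \<forall>h\<in>H. \<psi> (x \<otimes>\<^bsub>G\<^esub> h) = \<xi> h * \<psi> x}"

definition L_cov :: "('a, 'b) monoid_scheme \<Rightarrow> 'a topology \<Rightarrow> 'a measure \<Rightarrow> 'a set \<Rightarrow> ('a \<Rightarrow> complex) \<Rightarrow> real
    \<Rightarrow> ('a \<Rightarrow> complex) set complex_normed"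
  where "L_cov G T M H \<xi> r =
    Lp_space M r \<lparr>carrier := vclosure (Lp_space M r) (ae_class M ` M_cov G T H \<xi>)\<rparr>"

end

theory Submission
  imports Defs
begin

text \<open>
  No Radon-Nikodym theorem is available for the possibly non-\<open>\<sigma>\<close>-finite Haar measure, so the
  representing function of a functional \<open>\<phi>\<close> on the closed subspace \<open>L\<^sup>p\<^sub>\<xi>\<close> is found by
  uniform convexity: \<open>\<phi>\<close> attains its norm \<open>N\<close> at some \<open>u\<close> in the unit ball, and the first-order
  condition at \<open>u\<close> reads \<open>\<phi>(f) = N \<integral> f cnj(J u)\<close> with the Mazur map \<open>J u = |u|\<^sup>p\<^sup>-\<^sup>2 u\<close>.
  This map is continuous from \<open>L\<^sup>p\<close> to \<open>L\<^sup>q\<close> and preserves continuity, support and covariance,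
  hence \<open>M\<^sub>\<xi>\<close>, so \<open>J u\<close> lies in \<open>L\<^sup>q\<^sub>\<xi>\<close>. Conversely the norm of the functional
  of \<open>g \<in> L\<^sup>q\<^sub>\<xi>\<close> is attained at a multiple of \<open>|g|\<^sup>q\<^sup>-\<^sup>2 g \<in> L\<^sup>p\<^sub>\<xi>\<close>.
\<close>

section \<open>Homogeneous inequalities for pairs of complex numbers\<close>

text \<open>All estimates start pointwise, in the form
  \<open>A \<le> \<epsilon> * (|a|^p + |b|^p) + C * D\<close> for pairs of complex numbers, with
  every term homogeneous of degree p. Compactness of the unit sphere then yields C as soon as A is
  nonpositive wherever D vanishes. Integration turns this into uniform convexity, continuity of the
  norm and continuity of the Mazur map for all p > 1 at once, without Clarkson's inequalities and
  their case distinction at p = 2; the constants stay inexplicit, which does no harm. The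
  first-order condition is reached without differentiating under the integral: the tangent
  inequality of |.|^p at the perturbed point u + t f is integrated, and continuity of the Mazur map
  allows t to tend to 0. Covariance survives because the Mazur map commutes with scalars of modulus
  one, so the same \<xi> appears on both sides of the duality. The argument runs on functions; a.e.
  classes enter only when the result is transferred to the spaces of the statement.\<close>

lemma powr_strictly_midconvex_less:
  fixes x y p :: real
  assumes p: "1 < p" and "0 \<le> x" "x < y"
  shows "((x + y) / 2) powr p < (x powr p + y powr p) / 2"
proof -
  define m where "m = (x + y) / 2"
  have m: "x < m" "m < y" "m - x = y - m" using assms by (auto simp: m_def field_simps)
  have der: "((\<lambda>t. t powr p) has_real_derivative p * z powr (p - 1)) (at z)" if "0 < z" for z
    using that by (rule has_real_derivative_powr)
  have slope: "\<exists>z. a < z \<and> z < b \<and> b powr p - a powr p = (b - a) * (p * z powr (p - 1))"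
    if "0 \<le> a" "a < b" for a b
  proof -
    have "continuous_on {a..b} (\<lambda>t. t powr p)"
      using that p by (intro continuous_on_powr' continuous_intros) auto
    then obtain l z where z: "a < z" "z < b" "DERIV (\<lambda>t. t powr p) z :> l"
        "b powr p - a powr p = (b - a) * l"
      using MVT[of a b "\<lambda>t. t powr p"] \<open>a < b\<close> der real_differentiable_def \<open>0 \<le> a\<close>
      by (metis (no_types, lifting) le_less_trans)
    then have "l = p * z powr (p - 1)" using der[of z] DERIV_unique \<open>0 \<le> a\<close> by force
    with z show ?thesis by blast
  qed
  obtain z1 z2 where z: "x < z1" "z1 < m" "m < z2"
      "m powr p - x powr p = (m - x) * (p * z1 powr (p - 1))"
      "y powr p - m powr p = (y - m) * (p * z2 powr (p - 1))"
    using slope[of x m] slope[of m y] m assms by auto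
  have "z1 powr (p - 1) < z2 powr (p - 1)" using z assms by (intro powr_less_mono2) auto
  then have "(m - x) * (p * z1 powr (p - 1)) < (m - x) * (p * z2 powr (p - 1))" using m p by simp
  then have "m powr p - x powr p < y powr p - m powr p" using z m by simp
  then show ?thesis by (simp add: m_def)
qed

lemma powr_midconvex:
  fixes x y p :: real
  assumes "1 < p" "0 \<le> x" "0 \<le> y"
  shows "((x + y) / 2) powr p \<le> (x powr p + y powr p) / 2"
    and "((x + y) / 2) powr p = (x powr p + y powr p) / 2 \<Longrightarrow> x = y"
  using powr_strictly_midconvex_less[of p x y] powr_strictly_midconvex_less[of p y x] assms
  by (cases x y rule: linorder_cases; simp add: add.commute)+

lemma cmod_powr_midconvex:
  fixes a b :: complex
  assumes p: "1 < p"
  shows "cmod ((a + b) / 2) powr p \<le> (cmod a powr p + cmod b powr p) / 2"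
    and "cmod ((a + b) / 2) powr p = (cmod a powr p + cmod b powr p) / 2 \<Longrightarrow> a = b"
proof -
  have "cmod (a + b) \<le> cmod a + cmod b" by (rule norm_triangle_ineq)
  then have t: "cmod ((a + b) / 2) \<le> (cmod a + cmod b) / 2" by (simp add: norm_divide)
  then have le: "cmod ((a + b) / 2) powr p \<le> ((cmod a + cmod b) / 2) powr p"
    using p by (intro powr_mono2) auto
  note mid = powr_midconvex[OF p, of "cmod a" "cmod b"]
  show "cmod ((a + b) / 2) powr p \<le> (cmod a powr p + cmod b powr p) / 2"
    using le mid(1) by simp
  assume eq: "cmod ((a + b) / 2) powr p = (cmod a powr p + cmod b powr p) / 2"
  then have 1: "cmod a = cmod b" using le mid by simp
  then have "cmod ((a + b) / 2) powr p = ((cmod a + cmod b) / 2) powr p" using eq by simp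
  then have "cmod ((a + b) / 2) = (cmod a + cmod b) / 2"
    using t p powr_less_mono2[of p "cmod ((a + b) / 2)" "(cmod a + cmod b) / 2"] by force
  \<comment> \<open>Equality in the triangle inequality puts \<open>a\<close> and \<open>b\<close>
    on one ray, and equal moduli then make them equal.\<close>
  then have "cmod (a + b) = cmod a + cmod b" by (simp add: norm_divide)
  then have "cmod a *\<^sub>R b = cmod b *\<^sub>R a" by (simp add: norm_triangle_eq)
  with 1 show "a = b" by auto
qed

text \<open>Takes the place of Minkowski's inequality: integrated, it bounds p-th powers of norms of
  sums, and a crude constant is enough for that.\<close>

lemma cmod_powr_add_le:
  fixes a b :: complex
  assumes p: "1 < p"
  shows "cmod (a + b) powr p \<le> 2 powr p * (cmod a powr p + cmod b powr p)"
proof -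
  have "cmod (a + b) powr p = 2 powr p * cmod ((a + b) / 2) powr p"
    by (simp add: norm_divide powr_divide)
  also have "\<dots> \<le> 2 powr p * ((cmod a powr p + cmod b powr p) / 2)"
    using cmod_powr_midconvex(1)[OF p] by (intro mult_left_mono) auto
  also have "\<dots> \<le> 2 powr p * (cmod a powr p + cmod b powr p)"
    by (intro mult_left_mono) auto
  finally show ?thesis .
qed

text \<open>The case \<open>t = 0\<close> is included on purpose: with \<open>0 powr p = 0\<close>
  it forces \<open>f 0 = 0\<close>.\<close>

definition pos_homogeneous :: "real \<Rightarrow> ('v::real_vector \<Rightarrow> real) \<Rightarrow> bool"
  where "pos_homogeneous p f \<longleftrightarrow> (\<forall>t\<ge>0. \<forall>z. f (t *\<^sub>R z) = t powr p * f z)"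

text \<open>Homogeneity reduces the claim to the compact unit sphere. Only points with
  \<open>B z \<le> A z\<close> need help from \<open>D\<close>, and on the compact set of these
  points \<open>D\<close> has a positive minimum.\<close>

lemma homogeneous_dominated:
  fixes A B D :: "'v::euclidean_space \<Rightarrow> real"
  assumes cont: "continuous_on UNIV A" "continuous_on UNIV B" "continuous_on UNIV D"
    and hom: "pos_homogeneous p A" "pos_homogeneous p B" "pos_homogeneous p D"
    and nonneg: "\<And>z. 0 \<le> D z"
    and zero: "\<And>z. z \<noteq> 0 \<Longrightarrow> D z = 0 \<Longrightarrow> A z < B z"
  obtains C where "0 \<le> C" "\<And>z. A z \<le> B z + C * D z"
proof -
  define K where "K = sphere 0 1 \<inter> {z. B z \<le> A z}"
  have K: "compact K" unfolding K_def
    using cont by (intro compact_Int_closed compact_sphere closed_Collect_le)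
  have "\<exists>C\<ge>0. \<forall>z\<in>sphere 0 1. A z \<le> B z + C * D z"
  proof (cases "K = {}")
    case True
    then show ?thesis by (intro exI[of _ 0]) (auto simp: K_def not_le less_imp_le)
  next
    case False
    obtain z0 where z0: "z0 \<in> K" "\<And>z. z \<in> K \<Longrightarrow> D z0 \<le> D z"
      using continuous_attains_inf[OF K False continuous_on_subset[OF cont(3)]] by auto
    obtain z1 where z1: "z1 \<in> K" "\<And>z. z \<in> K \<Longrightarrow> A z - B z \<le> A z1 - B z1"
      using continuous_attains_sup[OF K False,  of "\<lambda>z. A z - B z"]
        continuous_on_subset[OF continuous_on_diff[OF cont(1,2)]] by auto
    have "z0 \<noteq> 0" using z0 by (auto simp: K_def)
    then have pos: "0 < D z0" using z0(1) zero[of z0] nonneg[of z0] by (force simp: K_def)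
    have ab: "0 \<le> A z1 - B z1" using z1 by (auto simp: K_def)
    \<comment> \<open>The constant is the maximum of \<open>A - B\<close> over \<open>K\<close>
      divided by the minimum of \<open>D\<close> over \<open>K\<close>.\<close>
    have "A z \<le> B z + (A z1 - B z1) / D z0 * D z" if "z \<in> sphere 0 1" for z
    proof (cases "z \<in> K")
      case True
      have "(A z1 - B z1) / D z0 * D z0 \<le> (A z1 - B z1) / D z0 * D z"
        using z0(2)[OF True] ab pos by (intro mult_left_mono) auto
      then show ?thesis using z1(2)[OF True] pos by simp
    next
      case False
      then have "A z \<le> B z" using that by (auto simp: K_def)
      moreover have "0 \<le> (A z1 - B z1) / D z0 * D z" using ab pos nonneg by simp
      ultimately show ?thesis by linarith
    qed
    then show ?thesis using ab pos by (intro exI[of _ "(A z1 - B z1) / D z0"]) auto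
  qed
  then obtain C where C: "C \<ge> 0" "\<And>z. z \<in> sphere 0 1 \<Longrightarrow> A z \<le> B z + C * D z" by auto
  have "A z \<le> B z + C * D z" for z
  proof -
    \<comment> \<open>For \<open>z = 0\<close> any unit vector serves, since the factor
      \<open>norm z powr p\<close> is then 0.\<close>
    define w where "w = (if z = 0 then (SOME b. b \<in> Basis) else z /\<^sub>R norm z)"
    have w: "w \<in> sphere 0 1" by (auto simp: w_def some_in_eq)
    have z: "z = norm z *\<^sub>R w" by (auto simp: w_def)
    have "f z = norm z powr p * f w" if "pos_homogeneous p f" for f
      using that z unfolding pos_homogeneous_def by (metis norm_ge_zero)
    then have "A z = norm z powr p * A w" "B z = norm z powr p * B w" "D z = norm z powr p * D w"
      using hom by auto
    moreover have "norm z powr p * A w \<le> norm z powr p * (B w + C * D w)"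
      using C(2)[OF w] by (intro mult_left_mono) auto
    ultimately show ?thesis by (simp add: algebra_simps)
  qed
  with C(1) show ?thesis by (rule that)
qed

section \<open>The Mazur map on the complex plane\<close>

text \<open>This is 1/p times the gradient of |z|^p on the real plane. For \<open>p < 2\<close> the
  origin causes no trouble, because \<open>0 powr (p - 2) = 0\<close>.\<close>

definition mazur :: "real \<Rightarrow> complex \<Rightarrow> complex"
  where "mazur p z = complex_of_real (cmod z powr (p - 2)) * z"

lemma mazur_0 [simp]: "mazur p 0 = 0" by (simp add: mazur_def)

lemma cmod_mazur: "cmod (mazur p z) = cmod z powr (p - 1)"
  using powr_mult_base[of "cmod z" "p - 2"] by (simp add: mazur_def norm_mult mult.commute)

lemma mult_cnj_mazur: "z * cnj (mazur p z) = complex_of_real (cmod z powr p)"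
proof (cases "z = 0")
  case False
  have "z * cnj (mazur p z) = complex_of_real (cmod z powr (p - 2)) * (z * cnj z)"
    by (simp add: mazur_def)
  also have "z * cnj z = complex_of_real (cmod z powr 2)"
    using False complex_norm_square[of z] by simp
  also have "complex_of_real (cmod z powr (p - 2)) * complex_of_real (cmod z powr 2)
      = complex_of_real (cmod z powr (p - 2) * cmod z powr 2)" by simp
  also have "cmod z powr (p - 2) * cmod z powr 2 = cmod z powr p"
    by (simp only: powr_add[symmetric]) simp
  finally show ?thesis .
qed simp

text \<open>Since \<xi> has values of modulus one, this equivariance lets the map preserve the
  covariance condition.\<close>

lemma mazur_mult_unit: "cmod w = 1 \<Longrightarrow> mazur p (w * z) = w * mazur p z"
  by (simp add: mazur_def norm_mult)

lemma mazur_scaleR: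
  assumes "0 \<le> t"
  shows "mazur p (t *\<^sub>R z) = (t powr (p - 1)) *\<^sub>R mazur p z"
  using powr_mult_base[OF assms, of "p - 2", symmetric] assms
  by (simp add: mazur_def powr_mult scaleR_conv_of_real norm_mult mult_ac)

lemma continuous_on_mazur:
  assumes "1 < p"
  shows "continuous_on UNIV (mazur p)"
proof -
  have "isCont (mazur p) z" for z
  proof (cases "z = 0")
    case True
    \<comment> \<open>For \<open>p < 2\<close> the factor |w|^(p-2) is unbounded near 0, so
      continuity there is read off from the modulus |w|^(p-1).\<close>
    have "((\<lambda>w. cmod w powr (p - 1)) \<longlongrightarrow> cmod 0 powr (p - 1)) (at 0)"
      using assms by (intro tendsto_intros) auto
    then have "((\<lambda>w. cmod (mazur p w)) \<longlongrightarrow> 0) (at 0)" by (simp add: cmod_mazur)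
    then show ?thesis using True by (simp add: isCont_def tendsto_norm_zero_iff)
  next
    case False
    then show ?thesis unfolding mazur_def by (intro continuous_intros) auto
  qed
  then show ?thesis by (simp add: continuous_at_imp_continuous_on)
qed

section \<open>Pointwise estimates from homogeneity and compactness\<close>

lemma continuous_on_cmod_powr:
  fixes f :: "'x::topological_space \<Rightarrow> complex"
  assumes "0 < p" "continuous_on X f"
  shows "continuous_on X (\<lambda>x. cmod (f x) powr p)"
  using assms by (intro continuous_on_powr' continuous_intros) auto

lemma pos_homogeneous_cmod_powr:
  assumes "\<And>t z. 0 \<le> t \<Longrightarrow> f (t *\<^sub>R z) = t *\<^sub>R f z"
  shows "pos_homogeneous p (\<lambda>z. cmod (f z) powr p)"
  using assms by (simp add: pos_homogeneous_def powr_mult)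

lemma pos_homogeneous_intros:
  "pos_homogeneous p f \<Longrightarrow> pos_homogeneous p g \<Longrightarrow> pos_homogeneous p (\<lambda>z. f z + g z)"
  "pos_homogeneous p f \<Longrightarrow> pos_homogeneous p g \<Longrightarrow> pos_homogeneous p (\<lambda>z. f z - g z)"
  "pos_homogeneous p f \<Longrightarrow> pos_homogeneous p (\<lambda>z. c * f z)"
  "pos_homogeneous p f \<Longrightarrow> pos_homogeneous p (\<lambda>z. f z / c)"
  by (simp_all add: pos_homogeneous_def algebra_simps)

text \<open>The comparison term with \<epsilon> is positive off the origin, so it suffices that
  \<open>A\<close> is nonpositive on the zero set of \<open>D\<close>. The estimates for differences
  of powers, for convexity and for the Mazur map are its three instances.\<close>

lemma cmod_powr_pair_dominated:
  fixes A D :: "complex \<Rightarrow> complex \<Rightarrow> real"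
  assumes "0 < p" "0 < \<epsilon>"
    and "continuous_on UNIV (\<lambda>z. A (fst z) (snd z))" "continuous_on UNIV (\<lambda>z. D (fst z) (snd z))"
    and "pos_homogeneous p (\<lambda>z. A (fst z) (snd z))"
      "pos_homogeneous p (\<lambda>z. D (fst z) (snd z))"
    and "\<And>a b. 0 \<le> D a b" "\<And>a b. D a b = 0 \<Longrightarrow> A a b \<le> 0"
  obtains C where "0 \<le> C"
    "\<And>a b. A a b \<le> \<epsilon> * (cmod a powr p + cmod b powr p) + C * D a b"
proof -
  let ?B = "\<lambda>z::complex \<times> complex. \<epsilon> * (cmod (fst z) powr p + cmod (snd z) powr p)"
  have "0 < ?B z" if "z \<noteq> 0" for z
  proof -
    have "0 < cmod (fst z) powr p + cmod (snd z) powr p"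
      using that by (cases z) (auto simp: zero_prod_def add_pos_nonneg add_nonneg_pos)
    then show ?thesis using assms(2) by simp
  qed
  moreover have "continuous_on UNIV ?B"
    using assms(1) by (intro continuous_intros continuous_on_cmod_powr)
  moreover have "pos_homogeneous p ?B"
    by (intro pos_homogeneous_intros pos_homogeneous_cmod_powr) auto
  ultimately obtain C where "0 \<le> C"
      "\<And>z. A (fst z) (snd z) \<le> ?B z + C * D (fst z) (snd z)"
    using homogeneous_dominated[of "\<lambda>z. A (fst z) (snd z)" ?B "\<lambda>z. D (fst z) (snd z)" p] assms
    by (smt (verit, best))
  then show ?thesis using that[of C] by (metis fst_conv snd_conv)
qed

text \<open>The term after \<open>C\<close> vanishes only for \<open>a = b\<close>, where the left
  side is 0. Integrated, this will keep an L^p limit of members of the unit ball inside the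
  ball.\<close>

lemma cmod_powr_diff_dominated:
  assumes p: "1 < p" and "0 < \<epsilon>"
  obtains C where "0 \<le> C"
    "\<And>a b. cmod a powr p - cmod b powr p
       \<le> \<epsilon> * (cmod a powr p + cmod b powr p) + C * cmod (a - b) powr p"
  by (rule cmod_powr_pair_dominated[of p \<epsilon>
        "\<lambda>a b. cmod a powr p - cmod b powr p" "\<lambda>a b. cmod (a - b) powr p"])
    (use assms in \<open>auto intro!: continuous_intros continuous_on_cmod_powr
        pos_homogeneous_intros pos_homogeneous_cmod_powr simp: scaleR_diff_right\<close>)

text \<open>The term after \<open>C\<close> is the midpoint defect of |.|^p; by the equality case in
  \<open>cmod_powr_midconvex\<close> it vanishes only on the diagonal.\<close>

lemma cmod_powr_uniformly_convex:
  assumes p: "1 < p" and "0 < \<epsilon>"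
  obtains C where "0 \<le> C"
    "\<And>a b. cmod (a - b) powr p \<le> \<epsilon> * (cmod a powr p + cmod b powr p)
       + C * ((cmod a powr p + cmod b powr p) / 2 - cmod ((a + b) / 2) powr p)"
proof (rule cmod_powr_pair_dominated[of p \<epsilon> "\<lambda>a b. cmod (a - b) powr p"
        "\<lambda>a b. (cmod a powr p + cmod b powr p) / 2 - cmod ((a + b) / 2) powr p"])
  show "cmod (a - b) powr p \<le> 0"
    if "(cmod a powr p + cmod b powr p) / 2 - cmod ((a + b) / 2) powr p = 0" for a b
    using cmod_powr_midconvex(2)[OF p, of a b] that by simp
  show "0 \<le> (cmod a powr p + cmod b powr p) / 2 - cmod ((a + b) / 2) powr p" for a b
    using cmod_powr_midconvex(1)[OF p, of a b] by simp
  show "pos_homogeneous p (\<lambda>z. cmod (fst z - snd z) powr p)"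
    "pos_homogeneous p (\<lambda>z. (cmod (fst z) powr p + cmod (snd z) powr p) / 2
      - cmod ((fst z + snd z) / 2) powr p)"
    by (intro pos_homogeneous_intros pos_homogeneous_cmod_powr;
        simp add: scaleR_conv_of_real algebra_simps)+
  show "continuous_on UNIV (\<lambda>z. cmod (fst z - snd z) powr p)"
    "continuous_on UNIV (\<lambda>z. (cmod (fst z) powr p + cmod (snd z) powr p) / 2
      - cmod ((fst z + snd z) / 2) powr p)"
    by (intro continuous_on_diff continuous_on_divide continuous_on_add continuous_on_cmod_powr
        continuous_on_fst continuous_on_snd continuous_on_id continuous_on_const; use p in simp)+
qed (assumption | rule that | use assms in simp)+

lemma conjugate_exponents:
  fixes p q :: real
  assumes "1 < p" "1 / p + 1 / q = 1"
  shows "q = p / (p - 1)" "(p - 1) * q = p" "1 < q"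
proof -
  have "q \<noteq> 0" using assms by auto
  then have *: "p + q = p * q" using assms by (simp add: field_simps)
  then show "q = p / (p - 1)" "(p - 1) * q = p"
    using assms by (simp_all add: field_simps)
  then show "1 < q" using assms by simp
qed

text \<open>The exponent \<open>q\<close> fits because the Mazur map is homogeneous of degree
  \<open>p - 1\<close> and \<open>(p - 1) * q = p\<close>, so both sides have degree
  \<open>p\<close>.\<close>

lemma mazur_diff_dominated:
  assumes p: "1 < p" and q: "1 / p + 1 / q = 1" and "0 < \<epsilon>"
  obtains C where "0 \<le> C"
    "\<And>a b. cmod (mazur p a - mazur p b) powr q
       \<le> \<epsilon> * (cmod a powr p + cmod b powr p) + C * cmod (a - b) powr p"
proof (rule cmod_powr_pair_dominated[of p \<epsilon> "\<lambda>a b. cmod (mazur p a - mazur p b) powr q"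
        "\<lambda>a b. cmod (a - b) powr p"])
  note pq = conjugate_exponents[OF p q]
  have "mazur p (t *\<^sub>R a) - mazur p (t *\<^sub>R b) = (t powr (p - 1)) *\<^sub>R (mazur p a - mazur p b)"
    if "0 \<le> t" for t a b using that by (simp add: mazur_scaleR scaleR_diff_right)
  then show "pos_homogeneous p (\<lambda>z. cmod (mazur p (fst z) - mazur p (snd z)) powr q)"
    using pq(2)
    by (auto simp: pos_homogeneous_def powr_mult powr_powr)
  show "continuous_on UNIV (\<lambda>z. cmod (mazur p (fst z) - mazur p (snd z)) powr q)"
    using pq(3) by (intro continuous_on_cmod_powr continuous_intros
        continuous_on_compose2[OF continuous_on_mazur[OF p]]) auto
qed (use assms that in \<open>auto intro!: continuous_intros continuous_on_cmod_powr
        pos_homogeneous_intros pos_homogeneous_cmod_powr simp: scaleR_diff_right\<close>)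

lemma cmod_mult_le_Young:
  assumes "1 < p" "1 / p + 1 / q = 1"
  shows "cmod (a * b) \<le> cmod a powr p / p + cmod b powr q / q"
  using Youngs_inequality[OF assms(1) conjugate_exponents(3)[OF assms] assms(2)]
  by (simp add: norm_mult)

text \<open>The tangent plane of the convex function |.|^p at \<open>b\<close> lies below its graph.
  Young's inequality for \<open>a\<close> and \<open>mazur p b\<close> gives this without any
  derivative, because the q-th power of the modulus of \<open>mazur p b\<close> is |b|^p.\<close>

lemma cmod_powr_tangent:
  assumes p: "1 < p"
  shows "cmod b powr p + p * Re ((a - b) * cnj (mazur p b)) \<le> cmod a powr p"
proof -
  define q where "q = p / (p - 1)"
  have q: "1 / p + 1 / q = 1" using p by (simp add: q_def field_simps)
  note pq = conjugate_exponents[OF p q]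
  have "Re (a * cnj (mazur p b)) \<le> cmod (a * cnj (mazur p b))" by (rule complex_Re_le_cmod)
  also have "\<dots> \<le> cmod a powr p / p + cmod (cnj (mazur p b)) powr q / q"
    by (rule cmod_mult_le_Young[OF p q])
  also have "cmod (cnj (mazur p b)) powr q = cmod b powr p"
    using pq(2) by (simp add: cmod_mazur powr_powr)
  finally have "Re (a * cnj (mazur p b)) \<le> cmod a powr p / p + cmod b powr p / q" .
  then have "p * Re (a * cnj (mazur p b)) \<le> p * (cmod a powr p / p + cmod b powr p / q)"
    using p by (intro mult_left_mono) auto
  also have "\<dots> = cmod a powr p + (p / q) * cmod b powr p"
    using p by (simp add: distrib_left)
  also have "p / q = p - 1" using p by (simp add: q_def)
  finally have "p * Re (a * cnj (mazur p b)) \<le> cmod a powr p + (p - 1) * cmod b powr p" .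
  moreover have "Re ((a - b) * cnj (mazur p b)) = Re (a * cnj (mazur p b)) - cmod b powr p"
    by (simp add: left_diff_distrib mult_cnj_mazur del: complex_cnj_mult times_complex.sel)
  ultimately show ?thesis by (simp add: algebra_simps)
qed

section \<open>The spaces of p-integrable functions\<close>

text \<open>This is the tangent inequality at the point 1, where \<open>mazur p 1 = 1\<close>; the
  assumption on \<open>s\<close> makes |1 + s| equal to 1 + s.\<close>

lemma powr_Bernoulli:
  fixes s :: real
  assumes "1 < p" "-1 \<le> s"
  shows "1 + p * s \<le> (1 + s) powr p"
  using cmod_powr_tangent[OF assms(1), of 1 "complex_of_real (1 + s)"] assms
  by (simp add: mazur_def norm_of_real del: of_real_add)

text \<open>The p-th power of the norm is kept without its root so that pointwise inequalities
  integrate directly. It is 0 for non-integrable integrands, which is why membership in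
  \<open>Lp_functions\<close> is carried along.\<close>

definition Lp_integral :: "'a measure \<Rightarrow> real \<Rightarrow> ('a \<Rightarrow> complex) \<Rightarrow> real"
  where "Lp_integral M p f = (LINT x|M. cmod (f x) powr p)"

lemma Lp_integral_nonneg [simp]: "0 \<le> Lp_integral M p f"
  by (simp add: Lp_integral_def)

lemma Lp_functionsD:
  assumes "f \<in> Lp_functions M p"
  shows "f \<in> borel_measurable M" "integrable M (\<lambda>x. cmod (f x) powr p)"
  using assms by (auto simp: Lp_functions_def)

lemma Lp_functions_bounded:
  assumes "f \<in> borel_measurable M" "integrable M g" "\<And>x. cmod (f x) powr p \<le> g x"
  shows "f \<in> Lp_functions M p"
proof -
  note [measurable] = assms(1)
  have "norm (cmod (f x) powr p) \<le> norm (g x)" for x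
    using assms(3)[of x] by simp
  then show ?thesis using assms(2)
    by (auto simp: Lp_functions_def intro!: Bochner_Integration.integrable_bound[OF assms(2)])
qed

lemma Lp_functions_scale:
  assumes "f \<in> Lp_functions M p"
  shows "(\<lambda>x. c * f x) \<in> Lp_functions M p"
    and "Lp_integral M p (\<lambda>x. c * f x) = cmod c powr p * Lp_integral M p f"
  using assms by (auto simp: Lp_functions_def Lp_integral_def norm_mult powr_mult)

lemma Lp_functions_add:
  assumes "1 < p" "f \<in> Lp_functions M p" "g \<in> Lp_functions M p"
  shows "(\<lambda>x. f x + g x) \<in> Lp_functions M p"
    and "Lp_integral M p (\<lambda>x. f x + g x) \<le> 2 powr p * (Lp_integral M p f + Lp_integral M p g)"
proof -
  note [measurable] = Lp_functionsD(1)[OF assms(2)] Lp_functionsD(1)[OF assms(3)]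
  note int = Lp_functionsD(2)[OF assms(2)] Lp_functionsD(2)[OF assms(3)]
  show *: "(\<lambda>x. f x + g x) \<in> Lp_functions M p"
    by (rule Lp_functions_bounded[OF _ _ cmod_powr_add_le[OF assms(1)]]) (use int in auto)
  have "Lp_integral M p (\<lambda>x. f x + g x)
      \<le> (LINT x|M. 2 powr p * (cmod (f x) powr p + cmod (g x) powr p))"
    unfolding Lp_integral_def
    by (rule integral_mono[OF Lp_functionsD(2)[OF *] _ cmod_powr_add_le[OF assms(1)]]) (use int in auto)
  then show "Lp_integral M p (\<lambda>x. f x + g x) \<le> 2 powr p * (Lp_integral M p f + Lp_integral M p g)"
    using int by (simp add: Lp_integral_def)
qed

lemma Lp_functions_diff:
  assumes "1 < p" "f \<in> Lp_functions M p" "g \<in> Lp_functions M p"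
  shows "(\<lambda>x. f x - g x) \<in> Lp_functions M p"
  using Lp_functions_add(1)[OF assms(1,2) Lp_functions_scale(1)[OF assms(3), of "-1"]] by simp

lemma Lp_integral_minus_commute:
  "Lp_integral M p (\<lambda>x. f x - g x) = Lp_integral M p (\<lambda>x. g x - f x)"
  by (simp add: Lp_integral_def norm_minus_commute)

lemma borel_measurable_mazur [measurable (raw)]:
  assumes "1 < p" "f \<in> borel_measurable M"
  shows "(\<lambda>x. mazur p (f x)) \<in> borel_measurable M"
  using measurable_compose[OF assms(2) borel_measurable_continuous_onI[OF continuous_on_mazur[OF assms(1)]]] .

lemma borel_measurable_cnj [measurable]: "cnj \<in> borel_measurable borel"
  by (intro borel_measurable_continuous_onI continuous_intros)

lemma Lp_functions_mazur:
  assumes "1 < p" "1 / p + 1 / q = 1" "f \<in> Lp_functions M p"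
  shows "(\<lambda>x. mazur p (f x)) \<in> Lp_functions M q"
    and "Lp_integral M q (\<lambda>x. mazur p (f x)) = Lp_integral M p f"
  using assms conjugate_exponents(2)[OF assms(1,2)] borel_measurable_mazur
  by (auto simp: Lp_functions_def Lp_integral_def cmod_mazur powr_powr)

lemma Lp_integral_eq_0D:
  assumes "f \<in> Lp_functions M p" "Lp_integral M p f = 0"
  shows "AE x in M. f x = 0"
  using assms integral_nonneg_eq_0_iff_AE[OF Lp_functionsD(2)[OF assms(1)]]
  by (auto simp: Lp_integral_def)

text \<open>Young's inequality alone gives integrability. For the sharp bound it is applied to
  \<open>f / s\<close> and \<open>g / t\<close> with \<open>s\<close> and \<open>t\<close> the two
  norms, after which the right side integrates to 1/p + 1/q = 1.\<close>

lemma Lp_functions_Holder: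
  assumes p: "1 < p" and pq: "1 / p + 1 / q = 1"
    and f: "f \<in> Lp_functions M p" and g: "g \<in> Lp_functions M q"
  shows "integrable M (\<lambda>x. f x * cnj (g x))"
    and "cmod (LINT x|M. f x * cnj (g x))
      \<le> Lp_integral M p f powr (1 / p) * Lp_integral M q g powr (1 / q)"
proof -
  note q = conjugate_exponents(3)[OF p pq]
  note [measurable] = Lp_functionsD(1)[OF f] Lp_functionsD(1)[OF g]
  note int = Lp_functionsD(2)[OF f] Lp_functionsD(2)[OF g]
  define I J where "I = Lp_integral M p f" and "J = Lp_integral M q g"
  have young: "cmod (a * cnj b) \<le> cmod a powr p / p + cmod b powr q / q" for a b
    using cmod_mult_le_Young[OF p pq, of a "cnj b"] by simp
  show fg: "integrable M (\<lambda>x. f x * cnj (g x))"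
  proof (rule Bochner_Integration.integrable_bound)
    show "integrable M (\<lambda>x. cmod (f x) powr p / p + cmod (g x) powr q / q)" using int by auto
    show "AE x in M. cmod (f x * cnj (g x)) \<le> norm (cmod (f x) powr p / p + cmod (g x) powr q / q)"
      using young p q by (auto intro!: AE_I2 order_trans[OF young])
  qed simp
  show "cmod (LINT x|M. f x * cnj (g x)) \<le> I powr (1 / p) * J powr (1 / q)"
  proof (cases "I = 0 \<or> J = 0")
    case True
    then have "AE x in M. f x * cnj (g x) = 0"
      using Lp_integral_eq_0D[OF f] Lp_integral_eq_0D[OF g] by (auto simp: I_def J_def)
    then have "(LINT x|M. f x * cnj (g x)) = (LINT x|M. 0)" by (intro integral_cong_AE) auto
    then show ?thesis by simp
  next
    case False
    then have pos: "0 < I" "0 < J" using Lp_integral_nonneg by (auto simp: I_def J_def less_le)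
    define s t where "s = I powr (1 / p)" and "t = J powr (1 / q)"
    have st: "0 < s" "0 < t" "s powr p = I" "t powr q = J"
      using pos p q by (auto simp: s_def t_def powr_powr)
    have "cmod (f x * cnj (g x)) \<le> s * t * (cmod (f x) powr p / (p * I) + cmod (g x) powr q / (q * J))" for x
    proof -
      have "cmod (f x / s * cnj (g x / t)) \<le> cmod (f x) powr p / (p * I) + cmod (g x) powr q / (q * J)"
        using young[of "f x / s" "g x / t"] st by (simp add: norm_divide powr_divide mult.commute)
      then have "s * t * cmod (f x / s * cnj (g x / t))
          \<le> s * t * (cmod (f x) powr p / (p * I) + cmod (g x) powr q / (q * J))"
        using st by (intro mult_left_mono) auto
      then show ?thesis using st by (simp add: norm_mult norm_divide)
    qed
    then have "(LINT x|M. cmod (f x * cnj (g x)))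
        \<le> (LINT x|M. s * t * (cmod (f x) powr p / (p * I) + cmod (g x) powr q / (q * J)))"
      using fg int by (intro integral_mono) auto
    also have "\<dots> = s * t * (I / (p * I) + J / (q * J))"
      using int by (simp add: I_def J_def Lp_integral_def)
    also have "\<dots> = s * t" using pos pq by simp
    finally show ?thesis unfolding s_def t_def by (rule order_trans[OF integral_norm_bound])
  qed
qed

lemma Lp_integral_diff_dominated:
  assumes p: "1 < p" and "0 < \<epsilon>"
  obtains C where "0 \<le> C"
    "\<And>f g. f \<in> Lp_functions M p \<Longrightarrow> g \<in> Lp_functions M p \<Longrightarrow>
       Lp_integral M p f - Lp_integral M p g \<le> \<epsilon> * (Lp_integral M p f + Lp_integral M p g)
         + C * Lp_integral M p (\<lambda>x. f x - g x)"
proof -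
  obtain C where C: "0 \<le> C"
    "\<And>a b. cmod a powr p - cmod b powr p
       \<le> \<epsilon> * (cmod a powr p + cmod b powr p) + C * cmod (a - b) powr p"
    using cmod_powr_diff_dominated[OF assms] by blast
  show ?thesis
  proof (rule that[OF C(1)])
    fix f g assume fg: "f \<in> Lp_functions M p" "g \<in> Lp_functions M p"
    note int = Lp_functionsD(2)[OF fg(1)] Lp_functionsD(2)[OF fg(2)]
      Lp_functionsD(2)[OF Lp_functions_diff[OF p fg]]
    have "(LINT x|M. cmod (f x) powr p - cmod (g x) powr p) \<le>
        (LINT x|M. \<epsilon> * (cmod (f x) powr p + cmod (g x) powr p) + C * cmod (f x - g x) powr p)"
      by (rule integral_mono) (use int C(2) in auto)
    then show "Lp_integral M p f - Lp_integral M p g \<le> \<epsilon> * (Lp_integral M p f + Lp_integral M p g)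
         + C * Lp_integral M p (\<lambda>x. f x - g x)"
      using int by (simp add: Lp_integral_def)
  qed
qed

text \<open>If \<open>f\<close> and \<open>g\<close> lie in the unit ball and their midpoint has
  integral close to 1, the bracket after \<open>C\<close> is small, so \<open>f\<close> and
  \<open>g\<close> are close. This will make maximizing sequences Cauchy.\<close>

lemma Lp_uniformly_convex:
  assumes p: "1 < p" and "0 < \<epsilon>"
  obtains C where "0 \<le> C"
    "\<And>f g. f \<in> Lp_functions M p \<Longrightarrow> g \<in> Lp_functions M p \<Longrightarrow>
       Lp_integral M p (\<lambda>x. f x - g x) \<le> \<epsilon> * (Lp_integral M p f + Lp_integral M p g)
         + C * ((Lp_integral M p f + Lp_integral M p g) / 2
                - Lp_integral M p (\<lambda>x. 1 / 2 * (f x + g x)))"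
proof -
  obtain C where C: "0 \<le> C"
    "\<And>a b. cmod (a - b) powr p \<le> \<epsilon> * (cmod a powr p + cmod b powr p)
       + C * ((cmod a powr p + cmod b powr p) / 2 - cmod ((a + b) / 2) powr p)"
    using cmod_powr_uniformly_convex[OF assms] by blast
  show ?thesis
  proof (rule that[OF C(1)])
    fix f g assume fg: "f \<in> Lp_functions M p" "g \<in> Lp_functions M p"
    note int = Lp_functionsD(2)[OF fg(1)] Lp_functionsD(2)[OF fg(2)]
      Lp_functionsD(2)[OF Lp_functions_diff[OF p fg]]
      Lp_functionsD(2)[OF Lp_functions_scale(1)[OF Lp_functions_add(1)[OF p fg], of "1 / 2"]]
    have "(LINT x|M. cmod (f x - g x) powr p) \<le>
        (LINT x|M. \<epsilon> * (cmod (f x) powr p + cmod (g x) powr p)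
          + C * ((cmod (f x) powr p + cmod (g x) powr p) / 2 - cmod (1 / 2 * (f x + g x)) powr p))"
    proof (rule integral_mono)
      show "cmod (f x - g x) powr p \<le> \<epsilon> * (cmod (f x) powr p + cmod (g x) powr p)
          + C * ((cmod (f x) powr p + cmod (g x) powr p) / 2 - cmod (1 / 2 * (f x + g x)) powr p)" for x
        using C(2)[of "f x" "g x"] by (simp only: times_divide_eq_left mult_1)
      show "integrable M (\<lambda>x. cmod (f x - g x) powr p)" by (rule int(3))
      show "integrable M (\<lambda>x. \<epsilon> * (cmod (f x) powr p + cmod (g x) powr p)
          + C * ((cmod (f x) powr p + cmod (g x) powr p) / 2 - cmod (1 / 2 * (f x + g x)) powr p))"
        by (intro Bochner_Integration.integrable_add Bochner_Integration.integrable_diff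
            integrable_mult_right integrable_divide int)
    qed
    also have "\<dots> = \<epsilon> * (Lp_integral M p f + Lp_integral M p g)
         + C * ((Lp_integral M p f + Lp_integral M p g) / 2
                - Lp_integral M p (\<lambda>x. 1 / 2 * (f x + g x)))"
      using int unfolding Lp_integral_def
      by (simp del: times_divide_eq_left mult_1)
    finally show "Lp_integral M p (\<lambda>x. f x - g x) \<le> \<epsilon> * (Lp_integral M p f + Lp_integral M p g)
         + C * ((Lp_integral M p f + Lp_integral M p g) / 2
                - Lp_integral M p (\<lambda>x. 1 / 2 * (f x + g x)))"
      by (simp only: Lp_integral_def)
  qed
qed

lemma Lp_mazur_diff_dominated:
  assumes p: "1 < p" and pq: "1 / p + 1 / q = 1" and "0 < \<epsilon>"
  obtains C where "0 \<le> C"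
    "\<And>f g. f \<in> Lp_functions M p \<Longrightarrow> g \<in> Lp_functions M p \<Longrightarrow>
       Lp_integral M q (\<lambda>x. mazur p (f x) - mazur p (g x))
         \<le> \<epsilon> * (Lp_integral M p f + Lp_integral M p g) + C * Lp_integral M p (\<lambda>x. f x - g x)"
proof -
  obtain C where C: "0 \<le> C"
    "\<And>a b. cmod (mazur p a - mazur p b) powr q
       \<le> \<epsilon> * (cmod a powr p + cmod b powr p) + C * cmod (a - b) powr p"
    using mazur_diff_dominated[OF assms] by blast
  show ?thesis
  proof (rule that[OF C(1)])
    fix f g assume fg: "f \<in> Lp_functions M p" "g \<in> Lp_functions M p"
    note q = conjugate_exponents(3)[OF p pq]
    note int = Lp_functionsD(2)[OF fg(1)] Lp_functionsD(2)[OF fg(2)]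
      Lp_functionsD(2)[OF Lp_functions_diff[OF p fg]]
      Lp_functionsD(2)[OF Lp_functions_diff[OF q Lp_functions_mazur(1)[OF p pq fg(1)]
          Lp_functions_mazur(1)[OF p pq fg(2)]]]
    have "(LINT x|M. cmod (mazur p (f x) - mazur p (g x)) powr q) \<le>
        (LINT x|M. \<epsilon> * (cmod (f x) powr p + cmod (g x) powr p) + C * cmod (f x - g x) powr p)"
      by (rule integral_mono) (use int C(2) in auto)
    then show "Lp_integral M q (\<lambda>x. mazur p (f x) - mazur p (g x))
         \<le> \<epsilon> * (Lp_integral M p f + Lp_integral M p g) + C * Lp_integral M p (\<lambda>x. f x - g x)"
      using int by (simp add: Lp_integral_def)
  qed
qed

lemma Lp_mazur_continuous:
  assumes p: "1 < p" and pq: "1 / p + 1 / q = 1" and "0 < \<epsilon>" and f: "f \<in> Lp_functions M p"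
  obtains \<delta> where "0 < \<delta>"
    "\<And>g. g \<in> Lp_functions M p \<Longrightarrow> Lp_integral M p (\<lambda>x. f x - g x) < \<delta> \<Longrightarrow>
       Lp_integral M q (\<lambda>x. mazur p (f x) - mazur p (g x)) < \<epsilon>"
proof -
  \<comment> \<open>\<open>B\<close> bounds the sum of the integrals of \<open>f\<close> and
    \<open>g\<close> for every \<open>g\<close> whose difference from \<open>f\<close> has integral
    at most 1; this is why \<delta> is capped at 1. The later \<open>B + 1\<close> and
    \<open>C + 1\<close> only avoid division by 0.\<close>
  define B where "B = Lp_integral M p f + 2 powr p * (Lp_integral M p f + 1)"
  have B: "0 \<le> B" by (simp add: B_def)
  then obtain C where C: "0 \<le> C"
    "\<And>f g. f \<in> Lp_functions M p \<Longrightarrow> g \<in> Lp_functions M p \<Longrightarrow>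
       Lp_integral M q (\<lambda>x. mazur p (f x) - mazur p (g x))
         \<le> \<epsilon> / (2 * (B + 1)) * (Lp_integral M p f + Lp_integral M p g)
           + C * Lp_integral M p (\<lambda>x. f x - g x)"
    using Lp_mazur_diff_dominated[OF p pq, of "\<epsilon> / (2 * (B + 1))" M] \<open>0 < \<epsilon>\<close> by auto
  show ?thesis
  proof (rule that)
    show "0 < min 1 (\<epsilon> / (2 * (C + 1)))" using C(1) \<open>0 < \<epsilon>\<close> by simp
    fix g assume g: "g \<in> Lp_functions M p"
      and *: "Lp_integral M p (\<lambda>x. f x - g x) < min 1 (\<epsilon> / (2 * (C + 1)))"
    have "Lp_integral M p (\<lambda>x. f x + -1 * (f x - g x))
        \<le> 2 powr p * (Lp_integral M p f + Lp_integral M p (\<lambda>x. -1 * (f x - g x)))"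
      by (intro Lp_functions_add Lp_functions_scale Lp_functions_diff f g p)
    also have "\<dots> \<le> 2 powr p * (Lp_integral M p f + 1)"
      using * Lp_functions_scale(2)[OF Lp_functions_diff[OF p f g], of "-1"]
      by (intro mult_left_mono) auto
    finally have "Lp_integral M p f + Lp_integral M p g \<le> B" by (simp add: B_def)
    then have "\<epsilon> / (2 * (B + 1)) * (Lp_integral M p f + Lp_integral M p g) \<le> \<epsilon> / (2 * (B + 1)) * B"
      using B \<open>0 < \<epsilon>\<close> by (intro mult_left_mono) auto
    also have "\<dots> \<le> \<epsilon> / 2" using B \<open>0 < \<epsilon>\<close> by (simp add: field_simps)
    finally have 1: "\<epsilon> / (2 * (B + 1)) * (Lp_integral M p f + Lp_integral M p g) \<le> \<epsilon> / 2" .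
    have "(C + 1) * Lp_integral M p (\<lambda>x. f x - g x) < (C + 1) * (\<epsilon> / (2 * (C + 1)))"
      using * C(1) by (intro mult_strict_left_mono) auto
    also have "\<dots> = \<epsilon> / 2" using C(1) by (simp add: field_simps)
    finally have "C * Lp_integral M p (\<lambda>x. f x - g x) < \<epsilon> / 2"
      using Lp_integral_nonneg[of M p "\<lambda>x. f x - g x"] unfolding distrib_right by linarith
    with 1 C(2)[OF f g] show "Lp_integral M q (\<lambda>x. mazur p (f x) - mazur p (g x)) < \<epsilon>" by linarith
  qed
qed

section \<open>Completeness\<close>

lemma convergent_of_geometric_increments:
  fixes v :: "nat \<Rightarrow> 'v::banach"
  assumes "\<forall>\<^sub>F i in sequentially. norm (v (Suc i) - v i) \<le> (1 / 2) ^ i"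
  shows "convergent v"
proof -
  have "summable (\<lambda>i. norm (v (Suc i) - v i))"
    by (rule summable_comparison_test_ev[OF _ summable_geometric[of "1 / 2 :: real"]])
      (use assms in auto)
  then have "summable (\<lambda>i. v (Suc i) - v i)" by (rule summable_norm_cancel)
  then have "(\<lambda>n. (\<Sum>i<n. v (Suc i) - v i)) \<longlonglongrightarrow> (\<Sum>i. v (Suc i) - v i)"
    by (rule summable_LIMSEQ)
  then have "(\<lambda>n. v n - v 0) \<longlonglongrightarrow> (\<Sum>i. v (Suc i) - v i)"
    by (simp add: sum_lessThan_telescope)
  from tendsto_add[OF this tendsto_const[of "v 0"]] show ?thesis
    by (auto simp: convergent_def)
qed

text \<open>The gap between the rates (1/4)^i and (1/2)^i pays for summability: the increments
  weighted by 2^i have p-th powers with integral at most (1/2)^(i p), hence at most (1/2)^i. So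
  these powers are summable a.e., tend to 0, and the increments themselves are eventually below
  (1/2)^i.\<close>

lemma Lp_AE_convergent:
  assumes p: "1 < p" and u: "\<And>n. u n \<in> Lp_functions M p"
    and fast: "\<And>i. Lp_integral M p (\<lambda>x. u (Suc i) x - u i x) \<le> ((1 / 4) ^ i) powr p"
  shows "AE x in M. convergent (\<lambda>i. u i x)"
proof -
  note [measurable] = Lp_functionsD(1)[OF u]
  define w where "w i x = (2 ^ i) powr p * cmod (u (Suc i) x - u i x) powr p" for i x
  have [measurable]: "w i \<in> borel_measurable M" for i unfolding w_def by measurable
  have w0: "0 \<le> w i x" for i x by (simp add: w_def)
  have "(\<integral>\<^sup>+x. ennreal (w i x) \<partial>M) \<le> ennreal ((1 / 2) ^ i)" for i
  proof -
    have "integrable M (w i)" unfolding w_def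
      by (intro integrable_mult_right Lp_functionsD(2)[OF Lp_functions_diff[OF p u u]])
    then have "(\<integral>\<^sup>+x. ennreal (w i x) \<partial>M) = ennreal (LINT x|M. w i x)"
      using w0 by (intro nn_integral_eq_integral) auto
    also have "(LINT x|M. w i x) = (2 ^ i) powr p * Lp_integral M p (\<lambda>x. u (Suc i) x - u i x)"
      by (simp add: w_def Lp_integral_def)
    also have "\<dots> \<le> (2 ^ i) powr p * ((1 / 4) ^ i) powr p"
      using fast by (intro mult_left_mono) auto
    also have "\<dots> = ((1 / 2) ^ i) powr p"
      by (simp add: powr_mult[symmetric] power_mult_distrib[symmetric])
    also have "\<dots> \<le> ((1 / 2) ^ i) powr 1"
      using p by (intro powr_mono') (auto simp: power_le_one)
    also have "\<dots> = (1 / 2) ^ i" by simp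
    finally show ?thesis by (simp add: ennreal_leI)
  qed
  then have "(\<Sum>i. \<integral>\<^sup>+x. ennreal (w i x) \<partial>M) \<le> (\<Sum>i. ennreal ((1 / 2) ^ i))"
    by (intro suminf_le) auto
  also have "\<dots> < \<infinity>"
    by (subst suminf_ennreal2) (auto intro!: summable_geometric)
  finally have "(\<integral>\<^sup>+x. (\<Sum>i. ennreal (w i x)) \<partial>M) \<noteq> \<infinity>" by (subst nn_integral_suminf) auto
  then have "AE x in M. (\<Sum>i. ennreal (w i x)) \<noteq> \<infinity>"
    by (intro nn_integral_PInf_AE) auto
  then show ?thesis
  proof eventually_elim
    case (elim x)
    then have "summable (\<lambda>i. w i x)" using w0 by (intro summable_suminf_not_top) auto
    then have "(\<lambda>i. w i x) \<longlonglongrightarrow> 0" by (rule summable_LIMSEQ_zero)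
    then have "\<forall>\<^sub>F i in sequentially. w i x < 1" by (rule order_tendstoD) simp
    then show ?case
    proof (intro convergent_of_geometric_increments, elim eventually_mono)
      fix i assume "w i x < 1"
      then have "(2 ^ i * cmod (u (Suc i) x - u i x)) powr p < 1 powr p" by (simp add: w_def powr_mult)
      then have "2 ^ i * cmod (u (Suc i) x - u i x) < 1"
        using p powr_mono2[of p 1 "2 ^ i * cmod (u (Suc i) x - u i x)"] by force
      then show "cmod (u (Suc i) x - u i x) \<le> (1 / 2) ^ i" by (simp add: field_simps)
    qed
  qed
qed

theorem Lp_complete:
  assumes p: "1 < p" and u: "\<And>n. u n \<in> Lp_functions M p"
    and Cauchy: "\<And>\<epsilon>. 0 < \<epsilon> \<Longrightarrow> \<exists>k. \<forall>m\<ge>k. \<forall>n\<ge>k. Lp_integral M p (\<lambda>x. u m x - u n x) \<le> \<epsilon>"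
  obtains f where "f \<in> Lp_functions M p" "(\<lambda>n. Lp_integral M p (\<lambda>x. u n x - f x)) \<longlonglongrightarrow> 0"
proof -
  note [measurable] = Lp_functionsD(1)[OF u]
  obtain K where K: "\<And>i m n. K i \<le> m \<Longrightarrow> K i \<le> n \<Longrightarrow>
      Lp_integral M p (\<lambda>x. u m x - u n x) \<le> ((1 / 4) ^ i) powr p"
    using Cauchy[of "((1 / 4) ^ i) powr p" for i] by (simp, metis)
  \<comment> \<open>The partial sums make \<open>r\<close> monotone and at least \<open>K i\<close>;
    the extra summand \<open>i\<close> sends it to infinity.\<close>
  define r where "r i = (\<Sum>j\<le>i. K j) + i" for i
  have r: "K i \<le> r i" "r i \<le> r (Suc i)" "i \<le> r i" for i
    by (auto simp: r_def intro: order_trans[OF member_le_sum[of i "{..i}" K]])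
  have K': "K i \<le> r (Suc i)" for i using r(1)[of i] r(2)[of i] by linarith
  have r_lim: "filterlim r at_top sequentially"
    using r(3) by (intro filterlim_at_top_mono[OF filterlim_ident]) auto
  define f where "f x = lim (\<lambda>i. u (r i) x)" for x
  have [measurable]: "f \<in> borel_measurable M" unfolding f_def by measurable
  have "AE x in M. convergent (\<lambda>i. u (r i) x)"
    by (rule Lp_AE_convergent[OF p u]) (rule K[OF K' r(1)])
  then have conv: "AE x in M. (\<lambda>i. u (r i) x) \<longlonglongrightarrow> f x"
    by eventually_elim (simp add: f_def convergent_LIMSEQ_iff)
  \<comment> \<open>Fatou's lemma along the subsequence \<open>r\<close> bounds the distance from
    \<open>f\<close> to every term \<open>u n\<close> that is close to all later terms. It also
    gives integrability of the difference, from which \<open>f\<close> itself inherits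
    membership.\<close>
  have Fatou: "(\<lambda>x. u n x - f x) \<in> Lp_functions M p \<and> Lp_integral M p (\<lambda>x. u n x - f x) \<le> \<epsilon>"
    if k: "\<And>m. k \<le> m \<Longrightarrow> Lp_integral M p (\<lambda>x. u n x - u m x) \<le> \<epsilon>" and \<epsilon>: "0 < \<epsilon>" for n k \<epsilon>
  proof -
    have "(\<integral>\<^sup>+x. ennreal (cmod (u n x - f x) powr p) \<partial>M)
        = (\<integral>\<^sup>+x. liminf (\<lambda>i. ennreal (cmod (u n x - u (r i) x) powr p)) \<partial>M)"
      using conv
    proof (intro nn_integral_cong_AE, eventually_elim)
      case (elim x)
      have "(\<lambda>i. ennreal (cmod (u n x - u (r i) x) powr p)) \<longlonglongrightarrow> ennreal (cmod (u n x - f x) powr p)"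
        using p elim by (intro tendsto_intros tendsto_ennrealI) auto
      then show ?case by (intro lim_imp_Liminf[symmetric]) auto
    qed
    also have "\<dots> \<le> liminf (\<lambda>i. \<integral>\<^sup>+x. ennreal (cmod (u n x - u (r i) x) powr p) \<partial>M)"
      by (intro nn_integral_liminf) auto
    also have "\<dots> \<le> ennreal \<epsilon>"
    proof (rule Liminf_le, simp, rule eventually_mono)
      show "\<forall>\<^sub>F i in sequentially. k \<le> r i"
        using r_lim by (simp add: filterlim_at_top)
      fix i assume "k \<le> r i"
      then show "(\<integral>\<^sup>+x. ennreal (cmod (u n x - u (r i) x) powr p) \<partial>M) \<le> ennreal \<epsilon>"
        using k[of "r i"] Lp_functionsD(2)[OF Lp_functions_diff[OF p u u]]
        by (subst nn_integral_eq_integral) (auto simp: Lp_integral_def intro!: ennreal_leI)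
    qed
    finally have *: "(\<integral>\<^sup>+x. ennreal (cmod (u n x - f x) powr p) \<partial>M) \<le> ennreal \<epsilon>" .
    then have int: "integrable M (\<lambda>x. cmod (u n x - f x) powr p)"
      using le_less_trans[OF * ennreal_less_top] by (intro integrableI_bounded) auto
    have "ennreal (Lp_integral M p (\<lambda>x. u n x - f x)) \<le> ennreal \<epsilon>"
      using * int by (subst (asm) nn_integral_eq_integral) (auto simp: Lp_integral_def)
    then show ?thesis using int \<epsilon> by (auto simp: Lp_functions_def)
  qed
  show ?thesis
  proof (rule that)
    obtain k where "\<forall>m\<ge>k. \<forall>n\<ge>k. Lp_integral M p (\<lambda>x. u m x - u n x) \<le> 1"
      using Cauchy[of 1] by auto
    then have "(\<lambda>x. u k x - f x) \<in> Lp_functions M p" using Fatou[of k k 1] by auto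
    from Lp_functions_diff[OF p u[of k] this] show "f \<in> Lp_functions M p" by simp
    show "(\<lambda>n. Lp_integral M p (\<lambda>x. u n x - f x)) \<longlonglongrightarrow> 0"
    proof (rule LIMSEQ_I)
      fix \<epsilon> :: real assume \<epsilon>: "0 < \<epsilon>"
      then obtain k where k: "\<And>m n. k \<le> m \<Longrightarrow> k \<le> n \<Longrightarrow> Lp_integral M p (\<lambda>x. u m x - u n x) \<le> \<epsilon> / 2"
        using Cauchy[of "\<epsilon> / 2"] by auto
      have "norm (Lp_integral M p (\<lambda>x. u n x - f x) - 0) < \<epsilon>" if "k \<le> n" for n
        using Fatou[of k n "\<epsilon> / 2"] k[OF that] \<epsilon> by auto
      then show "\<exists>k. \<forall>n\<ge>k. norm (Lp_integral M p (\<lambda>x. u n x - f x) - 0) < \<epsilon>" by blast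
    qed
  qed
qed

section \<open>Functionals on closed subspaces\<close>

text \<open>The subspace consists of functions, not classes. The closedness condition makes it
  saturated: a p-integrable function a.e. equal to a member has distance 0 from it and is a
  member.\<close>

locale closed_Lp_subspace =
  fixes M :: "'a measure" and p :: real and Y :: "('a \<Rightarrow> complex) set"
  assumes p: "1 < p"
    and subset: "Y \<subseteq> Lp_functions M p"
    and zero: "(\<lambda>x. 0) \<in> Y"
    and add: "f \<in> Y \<Longrightarrow> g \<in> Y \<Longrightarrow> (\<lambda>x. f x + g x) \<in> Y"
    and scale: "f \<in> Y \<Longrightarrow> (\<lambda>x. c * f x) \<in> Y"
    and closed: "f \<in> Lp_functions M p \<Longrightarrow>
      (\<And>\<epsilon>. 0 < \<epsilon> \<Longrightarrow> \<exists>s\<in>Y. Lp_integral M p (\<lambda>x. f x - s x) < \<epsilon>) \<Longrightarrow> f \<in> Y"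

locale bounded_Lp_functional = closed_Lp_subspace +
  fixes F :: "('a \<Rightarrow> complex) \<Rightarrow> complex" and C :: real
  assumes F_add: "f \<in> Y \<Longrightarrow> g \<in> Y \<Longrightarrow> F (\<lambda>x. f x + g x) = F f + F g"
    and F_scale: "f \<in> Y \<Longrightarrow> F (\<lambda>x. c * f x) = c * F f"
    and F_bounded: "f \<in> Y \<Longrightarrow> cmod (F f) \<le> C * Lp_integral M p f powr (1 / p)"
begin

definition norm_bound :: real
  where "norm_bound = (SUP f\<in>{f \<in> Y. Lp_integral M p f \<le> 1}. cmod (F f))"

lemma bdd_above_unit_ball: "bdd_above ((\<lambda>f. cmod (F f)) ` {f \<in> Y. Lp_integral M p f \<le> 1})"
proof (rule bdd_aboveI2)
  fix f assume f: "f \<in> {f \<in> Y. Lp_integral M p f \<le> 1}"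
  then have "Lp_integral M p f powr (1 / p) \<le> 1"
    using p powr_mono2[of "1 / p" "Lp_integral M p f" 1] by auto
  then have "C * Lp_integral M p f powr (1 / p) \<le> \<bar>C\<bar> * 1"
    by (intro mult_mono) auto
  then show "cmod (F f) \<le> \<bar>C\<bar>" using F_bounded[of f] f by auto
qed

lemma norm_bound_nonneg: "0 \<le> norm_bound"
proof -
  have "(\<lambda>x. 0) \<in> {f \<in> Y. Lp_integral M p f \<le> 1}" using zero by (simp add: Lp_integral_def)
  from cSUP_upper[OF this bdd_above_unit_ball] show ?thesis
    unfolding norm_bound_def using norm_ge_zero order_trans by blast
qed

lemma cmod_F_le:
  assumes f: "f \<in> Y"
  shows "cmod (F f) \<le> norm_bound * Lp_integral M p f powr (1 / p)"
proof (cases "Lp_integral M p f = 0")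
  case True
  \<comment> \<open>Normalization is impossible here, but \<open>0 powr (1 / p) = 0\<close> in the
    assumed bound gives \<open>F f = 0\<close>.\<close>
  then show ?thesis using F_bounded[OF f] by simp
next
  case False
  define s where "s = Lp_integral M p f powr (1 / p)"
  have pos: "0 < Lp_integral M p f" using False by (simp add: less_le)
  then have s: "0 < s" "s powr p = Lp_integral M p f" using p by (auto simp: s_def powr_powr)
  have "Lp_integral M p (\<lambda>x. complex_of_real (1 / s) * f x) = 1"
    using Lp_functions_scale(2)[of f M p "complex_of_real (1 / s)"] f subset s pos
    by (auto simp: norm_divide powr_divide)
  then have "cmod (F (\<lambda>x. complex_of_real (1 / s) * f x)) \<le> norm_bound"
    unfolding norm_bound_def
    by (intro cSUP_upper[OF _ bdd_above_unit_ball] CollectI conjI scale f) (simp only: order_refl)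
  then have "cmod (F f) / s \<le> norm_bound"
    using s unfolding F_scale[OF f] by (simp add: norm_mult norm_divide)
  then show ?thesis using s by (simp add: field_simps flip: s_def)
qed

lemma cmod_F_powr_le:
  assumes f: "f \<in> Y"
  shows "cmod (F f) powr p \<le> norm_bound powr p * Lp_integral M p f"
proof -
  have "cmod (F f) powr p \<le> (norm_bound * Lp_integral M p f powr (1 / p)) powr p"
    using p cmod_F_le[OF f] by (intro powr_mono2) auto
  also have "\<dots> = norm_bound powr p * Lp_integral M p f"
    using p by (simp add: powr_mult powr_powr)
  finally show ?thesis .
qed

lemma F_diff: "f \<in> Y \<Longrightarrow> g \<in> Y \<Longrightarrow> F (\<lambda>x. f x - g x) = F f - F g"
  using F_add[of f "\<lambda>x. -1 * g x"] F_scale[of g "-1"] scale[of g "-1"] by simp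

lemma diff: "f \<in> Y \<Longrightarrow> g \<in> Y \<Longrightarrow> (\<lambda>x. f x - g x) \<in> Y"
  using add[of f "\<lambda>x. -1 * g x"] scale[of g "-1"] by simp

text \<open>Rotating each near-maximizer by a unit scalar makes its value a nonnegative real, so
  that values at two of them add up without cancellation.\<close>

lemma maximizing_sequence:
  assumes "0 < norm_bound"
  obtains v where "\<And>n. v n \<in> Y" "\<And>n. Lp_integral M p (v n) \<le> 1"
    "\<And>n::nat. F (v n) = complex_of_real (cmod (F (v n)))"
    "\<And>n. norm_bound * (1 - 1 / Suc n) < cmod (F (v n))"
proof -
  let ?U = "{f \<in> Y. Lp_integral M p f \<le> 1}"
  have "\<exists>v\<in>?U. F v = complex_of_real (cmod (F v)) \<and> norm_bound * (1 - 1 / Suc n) < cmod (F v)" for n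
  proof -
    have "norm_bound * (1 - 1 / Suc n) < norm_bound * 1"
      using assms by (intro mult_strict_left_mono) auto
    then have "norm_bound * (1 - 1 / Suc n) < (SUP f\<in>?U. cmod (F f))" by (simp add: norm_bound_def)
    moreover have "?U \<noteq> {}" using zero by (auto simp: Lp_integral_def intro!: exI[of _ "\<lambda>x. 0"])
    ultimately obtain f where f: "f \<in> ?U" "norm_bound * (1 - 1 / Suc n) < cmod (F f)"
      using less_cSUP_iff[OF _ bdd_above_unit_ball] by blast
    define v where "v = (\<lambda>x. cnj (sgn (F f)) * f x)"
    \<comment> \<open>The strict lower bound is nonnegative even for \<open>n = 0\<close>, so
      \<open>F f\<close> is nonzero and \<open>sgn (F f)\<close> really has modulus one.\<close>
    have "0 \<le> norm_bound * (1 - 1 / Suc n)" using assms by simp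
    then have nz: "F f \<noteq> 0" using f(2) by auto
    have "F v = cnj (sgn (F f)) * F f" unfolding v_def using f by (intro F_scale) auto
    also have "\<dots> = complex_of_real (cmod (F f))"
      using nz complex_norm_square[of "F f"]
      by (simp add: sgn_div_norm scaleR_conv_of_real field_simps power2_eq_square)
    finally have Fv: "F v = complex_of_real (cmod (F f))" .
    have "cmod (cnj (sgn (F f))) = 1" using nz by (simp add: norm_sgn)
    then have "Lp_integral M p v = Lp_integral M p f"
      using Lp_functions_scale(2)[of f M p] f subset unfolding v_def by auto
    then show ?thesis using Fv f scale by (intro bexI[of _ v]) (auto simp: v_def)
  qed
  then have "\<exists>v. \<forall>n::nat. v n \<in> ?U \<and> F (v n) = complex_of_real (cmod (F (v n)))
      \<and> norm_bound * (1 - 1 / Suc n) < cmod (F (v n))"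
    by (intro choice) blast
  then show ?thesis using that by blast
qed

text \<open>Nonnegative real values average, so \<open>F\<close> is at least
  \<open>norm_bound * (1 - t)\<close> at the midpoint. A functional of norm
  \<open>norm_bound\<close> can be that large only if the midpoint has integral at least (1 - t)^p,
  and Bernoulli's inequality makes this linear in \<open>t\<close>.\<close>

lemma midpoint_lower_bound:
  assumes N: "0 < norm_bound" and f: "f \<in> Y" "g \<in> Y"
    and real: "F f = complex_of_real (cmod (F f))" "F g = complex_of_real (cmod (F g))"
    and t: "0 \<le> t" "t \<le> 1"
      "norm_bound * (1 - t) \<le> cmod (F f)" "norm_bound * (1 - t) \<le> cmod (F g)"
  shows "1 - p * t \<le> Lp_integral M p (\<lambda>x. 1 / 2 * (f x + g x))"
proof -
  have Y: "(\<lambda>x. 1 / 2 * (f x + g x)) \<in> Y" by (intro scale add f)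
  have "F (\<lambda>x. 1 / 2 * (f x + g x)) = 1 / 2 * (F f + F g)"
    using F_scale[OF add[OF f], of "1 / 2"] F_add[OF f] by simp
  also have "\<dots> = complex_of_real ((cmod (F f) + cmod (F g)) / 2)"
    by (subst real(1), subst real(2)) simp
  finally have "cmod (F (\<lambda>x. 1 / 2 * (f x + g x))) = \<bar>(cmod (F f) + cmod (F g)) / 2\<bar>"
    by (simp only: norm_of_real)
  moreover have "norm_bound * (1 - t) \<le> \<bar>(cmod (F f) + cmod (F g)) / 2\<bar>"
    using t(3,4) by (intro order_trans[OF _ abs_ge_self]) argo
  ultimately have "norm_bound * (1 - t) \<le> cmod (F (\<lambda>x. 1 / 2 * (f x + g x)))" by (simp only:)
  then have "(norm_bound * (1 - t)) powr p \<le> cmod (F (\<lambda>x. 1 / 2 * (f x + g x))) powr p"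
    using N t p by (intro powr_mono2) auto
  also have "\<dots> \<le> norm_bound powr p * Lp_integral M p (\<lambda>x. 1 / 2 * (f x + g x))"
    by (rule cmod_F_powr_le[OF Y])
  finally have "(1 - t) powr p \<le> Lp_integral M p (\<lambda>x. 1 / 2 * (f x + g x))"
    using N by (simp add: powr_mult)
  moreover have "1 - p * t \<le> (1 - t) powr p" using powr_Bernoulli[OF p, of "- t"] t by simp
  ultimately show ?thesis by linarith
qed

lemma norm_attained:
  assumes N: "0 < norm_bound"
  obtains u where "u \<in> Y" "Lp_integral M p u \<le> 1" "F u = complex_of_real norm_bound"
proof -
  obtain v where v: "\<And>n. v n \<in> Y" "\<And>n. Lp_integral M p (v n) \<le> 1"
    "\<And>n::nat. F (v n) = complex_of_real (cmod (F (v n)))"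
    "\<And>n. norm_bound * (1 - 1 / Suc n) < cmod (F (v n))"
    using maximizing_sequence[OF N] by blast
  have vL: "v n \<in> Lp_functions M p" for n using v subset by auto
  have "\<exists>k. \<forall>m\<ge>k. \<forall>n\<ge>k. Lp_integral M p (\<lambda>x. v m x - v n x) \<le> \<epsilon>" if \<epsilon>: "0 < \<epsilon>" for \<epsilon>
  proof -
    \<comment> \<open>Both integrals are at most 1, so \<epsilon>/4 contributes at most
      \<epsilon>/2; the other half is left for the midpoint defect.\<close>
    obtain K where K: "0 \<le> K" "\<And>f g. f \<in> Lp_functions M p \<Longrightarrow> g \<in> Lp_functions M p \<Longrightarrow>
       Lp_integral M p (\<lambda>x. f x - g x) \<le> \<epsilon> / 4 * (Lp_integral M p f + Lp_integral M p g)
         + K * ((Lp_integral M p f + Lp_integral M p g) / 2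
                - Lp_integral M p (\<lambda>x. 1 / 2 * (f x + g x)))"
      using Lp_uniformly_convex[OF p, of "\<epsilon> / 4" M] \<epsilon> by (auto simp del: times_divide_eq_left)
    \<comment> \<open>With \<open>t = 1 / Suc k\<close> the midpoint defect from index
      \<open>k\<close> on is at most \<open>p * t\<close>; this \<open>k\<close> makes
      \<open>K * (p * t)\<close> at most \<epsilon>/2.\<close>
    obtain k :: nat where "K * p / (\<epsilon> / 2) < k" using reals_Archimedean2 by blast
    then have "K * p \<le> \<epsilon> / 2 * Suc k" using \<epsilon> by (simp add: field_simps)
    moreover define t where "t = 1 / real (Suc k)"
    ultimately have t: "K * (p * t) \<le> \<epsilon> / 2" "0 \<le> t" "t \<le> 1"
      by (simp_all add: pos_divide_le_eq del: of_nat_Suc)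
    have "Lp_integral M p (\<lambda>x. v m x - v n x) \<le> \<epsilon>" if mn: "k \<le> m" "k \<le> n" for m n
    proof -
      have low: "norm_bound * (1 - t) \<le> cmod (F (v n))" if "k \<le> n" for n
      proof -
        have "1 / real (Suc n) \<le> 1 / real (Suc k)" using that by (intro divide_left_mono) auto
        then have "norm_bound * (1 - t) \<le> norm_bound * (1 - 1 / Suc n)"
          unfolding t_def using N by (intro mult_left_mono) auto
        then show ?thesis using v(4)[of n] by linarith
      qed
      have "1 - p * t \<le> Lp_integral M p (\<lambda>x. 1 / 2 * (v m x + v n x))"
        by (rule midpoint_lower_bound[OF N v(1) v(1) v(3) v(3) t(2,3) low low]) (use mn in auto)
      then have "K * ((Lp_integral M p (v m) + Lp_integral M p (v n)) / 2
                - Lp_integral M p (\<lambda>x. 1 / 2 * (v m x + v n x))) \<le> K * (p * t)"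
        using K(1) v(2)[of m] v(2)[of n] by (intro mult_left_mono) argo+
      also have "\<dots> \<le> \<epsilon> / 2" by (rule t(1))
      finally have "K * ((Lp_integral M p (v m) + Lp_integral M p (v n)) / 2
                - Lp_integral M p (\<lambda>x. 1 / 2 * (v m x + v n x))) \<le> \<epsilon> / 2" .
      moreover have "\<epsilon> / 4 * (Lp_integral M p (v m) + Lp_integral M p (v n)) \<le> \<epsilon> / 4 * 2"
        using \<epsilon> v(2)[of m] v(2)[of n] by (intro mult_left_mono) auto
      ultimately show ?thesis using K(2)[OF vL vL, of m n] by linarith
    qed
    then show ?thesis by blast
  qed
  from Lp_complete[OF p vL this] obtain u where u: "u \<in> Lp_functions M p"
    and lim: "(\<lambda>n. Lp_integral M p (\<lambda>x. v n x - u x)) \<longlonglongrightarrow> 0" by blast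
  have uY: "u \<in> Y"
  proof (rule closed[OF u])
    fix \<epsilon> :: real assume "0 < \<epsilon>"
    from order_tendstoD(2)[OF lim this] obtain n where "Lp_integral M p (\<lambda>x. v n x - u x) < \<epsilon>"
      by (auto simp: eventually_sequentially)
    then show "\<exists>s\<in>Y. Lp_integral M p (\<lambda>x. u x - s x) < \<epsilon>"
      using v(1) by (metis Lp_integral_minus_commute)
  qed
  show ?thesis
  proof (rule that[OF uY])
    \<comment> \<open>\<open>K\<close> depends on \<epsilon>, so \<open>n\<close> tends to infinity
      first and \<epsilon> to 0 only afterwards.\<close>
    have "Lp_integral M p u - 1 \<le> \<epsilon> * (Lp_integral M p u + 1)" if \<epsilon>: "0 < \<epsilon>" for \<epsilon>
    proof -
      obtain K where K: "0 \<le> K" "\<And>f g. f \<in> Lp_functions M p \<Longrightarrow> g \<in> Lp_functions M p \<Longrightarrow>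
         Lp_integral M p f - Lp_integral M p g \<le> \<epsilon> * (Lp_integral M p f + Lp_integral M p g)
           + K * Lp_integral M p (\<lambda>x. f x - g x)"
        using Lp_integral_diff_dominated[OF p \<epsilon>, of M] by blast
      have "Lp_integral M p u - 1 \<le> \<epsilon> * (Lp_integral M p u + 1)
          + K * Lp_integral M p (\<lambda>x. v n x - u x)" for n
      proof -
        have "\<epsilon> * (Lp_integral M p u + Lp_integral M p (v n)) \<le> \<epsilon> * (Lp_integral M p u + 1)"
          using \<epsilon> v(2)[of n] by (intro mult_left_mono) auto
        then show ?thesis
          using K(2)[OF u vL[of n]] v(2)[of n]
          unfolding Lp_integral_minus_commute[of M p u "v n"] by linarith
      qed
      moreover have "(\<lambda>n. \<epsilon> * (Lp_integral M p u + 1) + K * Lp_integral M p (\<lambda>x. v n x - u x))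
          \<longlonglongrightarrow> \<epsilon> * (Lp_integral M p u + 1) + K * 0"
        by (intro tendsto_intros lim)
      ultimately show ?thesis by (intro LIMSEQ_le_const[of _ "\<epsilon> * (Lp_integral M p u + 1)"]) auto
    qed
    note * = this
    have "Lp_integral M p u - 1 \<le> 0 + e" if "0 < e" for e
    proof -
      have "0 < Lp_integral M p u + 1" by (rule add_nonneg_pos) auto
      then show ?thesis using *[of "e / (Lp_integral M p u + 1)"] that by simp
    qed
    then have "Lp_integral M p u - 1 \<le> 0" by (rule field_le_epsilon)
    then show "Lp_integral M p u \<le> 1" by simp
    \<comment> \<open>The values \<open>F (v n)\<close> converge to \<open>norm_bound\<close> by
      squeezing and to \<open>F u\<close> by boundedness of \<open>F\<close>, so the two limits
      agree.\<close>
    have bound: "cmod (F (v n)) \<le> norm_bound" for n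
      unfolding norm_bound_def using v by (intro cSUP_upper[OF _ bdd_above_unit_ball]) auto
    have "(\<lambda>n. norm_bound * (1 - 1 / real (Suc n))) \<longlonglongrightarrow> norm_bound * (1 - 0)"
      by (intro tendsto_intros LIMSEQ_Suc[OF lim_1_over_n])
    then have "(\<lambda>n. norm_bound * (1 - 1 / real (Suc n))) \<longlonglongrightarrow> norm_bound" by simp
    then have "(\<lambda>n. cmod (F (v n))) \<longlonglongrightarrow> norm_bound"
    proof (rule tendsto_sandwich[rotated 2, OF _ tendsto_const])
      show "\<forall>\<^sub>F n in sequentially. norm_bound * (1 - 1 / real (Suc n)) \<le> cmod (F (v n))"
        by (intro always_eventually allI less_imp_le v(4))
      show "\<forall>\<^sub>F n in sequentially. cmod (F (v n)) \<le> norm_bound"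
        by (intro always_eventually allI bound)
    qed
    then have "(\<lambda>n. complex_of_real (cmod (F (v n)))) \<longlonglongrightarrow> complex_of_real norm_bound"
      by (rule tendsto_of_real)
    then have 1: "(\<lambda>n. F (v n)) \<longlonglongrightarrow> complex_of_real norm_bound" by (simp only: v(3)[symmetric])
    have "(\<lambda>n. norm_bound * Lp_integral M p (\<lambda>x. v n x - u x) powr (1 / p)) \<longlonglongrightarrow> 0"
      by (rule tendsto_eq_rhs, rule tendsto_mult[OF tendsto_const tendsto_powr'[OF lim tendsto_const]])
        (use p in simp_all)
    moreover have "norm (F (v n) - F u) \<le> norm_bound * Lp_integral M p (\<lambda>x. v n x - u x) powr (1 / p)" for n
      using cmod_F_le[OF diff[OF v(1) uY]] F_diff[OF v(1) uY] by simp
    ultimately have "(\<lambda>n. F (v n) - F u) \<longlonglongrightarrow> 0"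
      by (rule Lim_null_comparison[OF always_eventually, OF allI, rotated])
    then have "(\<lambda>n. F (v n)) \<longlonglongrightarrow> F u" by (rule LIM_zero_cancel)
    then show "F u = complex_of_real norm_bound" using 1 by (rule LIMSEQ_unique)
  qed
qed

text \<open>Compares the values at \<open>t = 0\<close> and \<open>t > 0\<close> of
  \<open>N\<^sup>p \<integral> |u + t f|\<^sup>p - |F (u + t f)|\<^sup>p \<ge> 0\<close>, which vanishes at \<open>t = 0\<close>.\<close>

lemma Re_F_le_near_maximizer:
  assumes pq: "1 / p + 1 / q = 1"
    and N: "0 < norm_bound" and u: "u \<in> Y" "Lp_integral M p u \<le> 1" "F u = complex_of_real norm_bound"
    and f: "f \<in> Y" and t: "0 < t" "t * \<bar>Re (F f)\<bar> \<le> norm_bound"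
  shows "Re (F f) \<le> norm_bound * Re (LINT x|M. f x * cnj (mazur p (u x + complex_of_real t * f x)))"
proof -
  define w where "w x = u x + complex_of_real t * f x" for x
  have wY: "w \<in> Y" unfolding w_def by (intro add scale u f)
  have L: "u \<in> Lp_functions M p" "f \<in> Lp_functions M p" "w \<in> Lp_functions M p"
    using u f wY subset by auto
  note int = Lp_functionsD(2)[OF L(1)] Lp_functionsD(2)[OF L(3)]
    Lp_functions_Holder(1)[OF p pq L(2) Lp_functions_mazur(1)[OF p pq L(3)]]
  define R where "R = Re (LINT x|M. f x * cnj (mazur p (w x)))"
  \<comment> \<open>The tangent is taken at \<open>w\<close>, not at \<open>u\<close>: only this
    gives an upper bound for the integral of |w|^p. The price is that the Mazur map is evaluated at
    the perturbed point.\<close>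
  have "(LINT x|M. cmod (w x) powr p - p * t * Re (f x * cnj (mazur p (w x)))) \<le> (LINT x|M. cmod (u x) powr p)"
  proof (rule integral_mono)
    show "integrable M (\<lambda>x. cmod (w x) powr p - p * t * Re (f x * cnj (mazur p (w x))))"
      by (intro Bochner_Integration.integrable_diff integrable_mult_right integrable_Re int)
    show "cmod (w x) powr p - p * t * Re (f x * cnj (mazur p (w x))) \<le> cmod (u x) powr p" for x
    proof -
      have "(u x - w x) * cnj (mazur p (w x)) = complex_of_real (- t) * (f x * cnj (mazur p (w x)))"
        by (simp add: w_def)
      then have "Re ((u x - w x) * cnj (mazur p (w x))) = - t * Re (f x * cnj (mazur p (w x)))"
        by (simp only: Re_complex_of_real Im_complex_of_real times_complex.sel mult_zero_left diff_zero)
      then show ?thesis using cmod_powr_tangent[OF p, of "w x" "u x"]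
        by (simp only: mult_minus_left mult_minus_right mult.assoc)
    qed
  qed (rule int)
  moreover have "(LINT x|M. cmod (w x) powr p - p * t * Re (f x * cnj (mazur p (w x))))
      = Lp_integral M p w - p * t * R"
    using int unfolding R_def Lp_integral_def integral_Re[OF int(3), symmetric]
    by (subst Bochner_Integration.integral_diff) (auto simp del: times_complex.sel)
  ultimately have "Lp_integral M p w \<le> 1 + p * t * R" using u(2) by (simp add: Lp_integral_def)
  then have up: "norm_bound powr p * Lp_integral M p w \<le> norm_bound powr p * (1 + p * t * R)"
    by (intro mult_left_mono) auto
  have "F w = F u + complex_of_real t * F f"
    unfolding w_def using F_add[OF u(1) scale[OF f]] F_scale[OF f] by simp
  then have "Re (F w) = norm_bound + t * Re (F f)" using u by simp
  then have "norm_bound + t * Re (F f) \<le> cmod (F w)" using complex_Re_le_cmod[of "F w"] by simp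
  \<comment> \<open>The smallness condition on \<open>t\<close> is what Bernoulli's inequality
    requires; it also makes the base of the next power nonnegative.\<close>
  moreover have s: "- 1 \<le> t * Re (F f) / norm_bound"
  proof -
    have "\<bar>t * Re (F f)\<bar> \<le> norm_bound" using t by (simp add: abs_mult)
    then show ?thesis using N by (simp add: field_simps)
  qed
  moreover have eq: "norm_bound + t * Re (F f) = norm_bound * (1 + t * Re (F f) / norm_bound)"
    using N by (simp add: field_simps)
  ultimately have "(norm_bound * (1 + t * Re (F f) / norm_bound)) powr p \<le> cmod (F w) powr p"
    using N p by (intro powr_mono2) auto
  also have "\<dots> \<le> norm_bound powr p * (1 + p * t * R)" using cmod_F_powr_le[OF wY] up by linarith
  finally have "(1 + t * Re (F f) / norm_bound) powr p \<le> 1 + p * t * R" using N by (simp add: powr_mult)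
  then have "p * (t * Re (F f) / norm_bound) \<le> p * t * R" using powr_Bernoulli[OF p s] by linarith
  then have "Re (F f) \<le> norm_bound * R" using p t N by (simp add: field_simps)
  then show ?thesis by (simp add: R_def w_def)
qed

text \<open>The perturbed inequality is used with t = 1/(n+1). Hoelder's inequality bounds the
  change of the pairing by the L^q distance of the Mazur images, which tends to 0 by continuity of
  the Mazur map.\<close>

lemma Re_F_le:
  assumes pq: "1 / p + 1 / q = 1"
    and N: "0 < norm_bound" and u: "u \<in> Y" "Lp_integral M p u \<le> 1" "F u = complex_of_real norm_bound"
    and f: "f \<in> Y"
  shows "Re (F f) \<le> norm_bound * Re (LINT x|M. f x * cnj (mazur p (u x)))"
proof -
  have L: "u \<in> Lp_functions M p" "f \<in> Lp_functions M p" using u f subset by auto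
  note q = conjugate_exponents(3)[OF p pq]
  define w where "w n x = u x + complex_of_real (1 / real (Suc n)) * f x" for n x
  have wY: "w n \<in> Y" for n unfolding w_def by (intro add scale u f)
  then have wL: "w n \<in> Lp_functions M p" for n using subset by auto
  note mL = Lp_functions_mazur(1)[OF p pq]
  note Hol = Lp_functions_Holder[OF p pq L(2)]
  have t0: "(\<lambda>n. 1 / real (Suc n)) \<longlonglongrightarrow> 0" by (rule LIMSEQ_Suc[OF lim_1_over_n])
  have "Lp_integral M p (\<lambda>x. u x - w n x) = (1 / Suc n) powr p * Lp_integral M p f" for n
    using Lp_functions_scale(2)[OF L(2), of "- complex_of_real (1 / Suc n)"]
    by (simp only: w_def) (simp add: norm_divide del: of_nat_Suc)
  moreover have "(\<lambda>n. (1 / Suc n) powr p * Lp_integral M p f) \<longlonglongrightarrow> 0 powr p * Lp_integral M p f"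
    using p by (intro tendsto_intros t0) auto
  ultimately have wlim: "(\<lambda>n. Lp_integral M p (\<lambda>x. u x - w n x)) \<longlonglongrightarrow> 0" by simp
  have mlim: "(\<lambda>n. Lp_integral M q (\<lambda>x. mazur p (u x) - mazur p (w n x))) \<longlonglongrightarrow> 0"
  proof (rule order_tendstoI)
    fix e :: real assume "0 < e"
    then obtain d where d: "0 < d" "\<And>g. g \<in> Lp_functions M p \<Longrightarrow>
        Lp_integral M p (\<lambda>x. u x - g x) < d \<Longrightarrow>
        Lp_integral M q (\<lambda>x. mazur p (u x) - mazur p (g x)) < e"
      using Lp_mazur_continuous[OF p pq _ L(1)] by metis
    show "\<forall>\<^sub>F n in sequentially. Lp_integral M q (\<lambda>x. mazur p (u x) - mazur p (w n x)) < e"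
      using order_tendstoD(2)[OF wlim d(1)] by eventually_elim (rule d(2)[OF wL])
  next
    fix e :: real assume "e < 0"
    then show "\<forall>\<^sub>F n in sequentially. e < Lp_integral M q (\<lambda>x. mazur p (u x) - mazur p (w n x))"
      by (intro always_eventually allI) (rule less_le_trans[OF _ Lp_integral_nonneg])
  qed
  have bound_lim: "(\<lambda>n. Lp_integral M p f powr (1 / p)
        * Lp_integral M q (\<lambda>x. mazur p (u x) - mazur p (w n x)) powr (1 / q))
      \<longlonglongrightarrow> 0"
    by (rule tendsto_eq_rhs, rule tendsto_mult[OF tendsto_const tendsto_powr'[OF mlim tendsto_const]]) (use q in simp_all)
  have bound: "norm ((LINT x|M. f x * cnj (mazur p (u x))) - (LINT x|M. f x * cnj (mazur p (w n x))))
      \<le> Lp_integral M p f powr (1 / p)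
        * Lp_integral M q (\<lambda>x. mazur p (u x) - mazur p (w n x)) powr (1 / q)" for n
  proof -
    have "(LINT x|M. f x * cnj (mazur p (u x))) - (LINT x|M. f x * cnj (mazur p (w n x)))
        = (LINT x|M. f x * cnj (mazur p (u x) - mazur p (w n x)))"
      using Hol(1)[OF mL[OF L(1)]] Hol(1)[OF mL[OF wL]]
      by (simp add: right_diff_distrib)
    then show ?thesis
      using Hol(2)[OF Lp_functions_diff[OF q mL[OF L(1)] mL[OF wL]]] by simp
  qed
  have "(\<lambda>n. (LINT x|M. f x * cnj (mazur p (u x))) - (LINT x|M. f x * cnj (mazur p (w n x)))) \<longlonglongrightarrow> 0"
    by (rule Lim_null_comparison[OF always_eventually[OF allI[OF bound]] bound_lim])
  from tendsto_diff[OF tendsto_const[of "LINT x|M. f x * cnj (mazur p (u x))"] this]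
  have "(\<lambda>n. LINT x|M. f x * cnj (mazur p (w n x))) \<longlonglongrightarrow> (LINT x|M. f x * cnj (mazur p (u x)))"
    by simp
  then have "(\<lambda>n. norm_bound * Re (LINT x|M. f x * cnj (mazur p (w n x))))
      \<longlonglongrightarrow> norm_bound * Re (LINT x|M. f x * cnj (mazur p (u x)))"
    by (intro tendsto_intros)
  moreover have "(\<lambda>n. 1 / real (Suc n) * \<bar>Re (F f)\<bar>) \<longlonglongrightarrow> 0 * \<bar>Re (F f)\<bar>"
    by (intro tendsto_intros t0)
  then have "\<forall>\<^sub>F n in sequentially. 1 / real (Suc n) * \<bar>Re (F f)\<bar> < norm_bound"
    using N by (intro order_tendstoD) auto
  then have "\<forall>\<^sub>F n in sequentially. Re (F f) \<le> norm_bound * Re (LINT x|M. f x * cnj (mazur p (w n x)))"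
    by eventually_elim (unfold w_def, rule Re_F_le_near_maximizer[OF pq N u f], simp_all)
  ultimately show ?thesis by (rule tendsto_lowerbound) simp
qed

text \<open>The one-sided inequality for real parts holds on a complex subspace: inserting -f turns
  it into an equality, and inserting i f gives the imaginary parts.\<close>

theorem represented:
  assumes pq: "1 / p + 1 / q = 1"
  obtains u c where "u \<in> Y" "\<And>f. f \<in> Y \<Longrightarrow> F f = (LINT x|M. f x * cnj (c * mazur p (u x)))"
proof (cases "norm_bound = 0")
  case True
  then have "F f = 0" if "f \<in> Y" for f using cmod_F_le[OF that] by simp
  then show ?thesis using that[OF zero, of 0] by simp
next
  case False
  then have N: "0 < norm_bound" using norm_bound_nonneg by simp
  obtain u where u: "u \<in> Y" "Lp_integral M p u \<le> 1" "F u = complex_of_real norm_bound"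
    using norm_attained[OF N] .
  note le = Re_F_le[OF pq N u]
  let ?\<Lambda> = "\<lambda>f. LINT x|M. f x * cnj (mazur p (u x))"
  have Re_eq: "Re (F f) = norm_bound * Re (?\<Lambda> f)" if f: "f \<in> Y" for f
    using le[OF f] le[OF scale[OF f, of "-1"]] F_scale[OF f, of "-1"] by simp
  have *: "F f = norm_bound * ?\<Lambda> f" if f: "f \<in> Y" for f
  proof (rule complex_eqI)
    have "?\<Lambda> (\<lambda>x. \<i> * f x) = \<i> * ?\<Lambda> f" by (simp add: mult.assoc)
    then show "Im (F f) = Im (norm_bound * ?\<Lambda> f)"
      using Re_eq[OF scale[OF f, of \<i>]] F_scale[OF f, of \<i>] by simp
  qed (simp add: Re_eq[OF f])
  have "F f = (LINT x|M. f x * cnj (complex_of_real norm_bound * mazur p (u x)))" if "f \<in> Y" for f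
  proof -
    have "f x * cnj (complex_of_real norm_bound * mazur p (u x))
        = complex_of_real norm_bound * (f x * cnj (mazur p (u x)))" for x
      by (simp add: mult.left_commute)
    then show ?thesis using *[OF that] by (simp only: integral_mult_right_zero)
  qed
  with u(1) show ?thesis by (rule that)
qed

end

section \<open>Closures, duality and covariant functions\<close>

text \<open>The counterpart of \<open>vclosure\<close> for functions. Approximants must be
  p-integrable themselves, since otherwise the integral of the difference would be 0 by default and
  approximate anything.\<close>

definition Lp_closure :: "'a measure \<Rightarrow> real \<Rightarrow> ('a \<Rightarrow> complex) set \<Rightarrow> ('a \<Rightarrow> complex) set"
  where "Lp_closure M p S = {f \<in> Lp_functions M p.
    \<forall>\<epsilon>>0. \<exists>s\<in>S \<inter> Lp_functions M p. Lp_integral M p (\<lambda>x. f x - s x) < \<epsilon>}"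

lemma Lp_closureD:
  assumes "f \<in> Lp_closure M p S"
  shows "f \<in> Lp_functions M p"
    and "0 < \<epsilon> \<Longrightarrow> \<exists>s\<in>S \<inter> Lp_functions M p. Lp_integral M p (\<lambda>x. f x - s x) < \<epsilon>"
  using assms by (auto simp: Lp_closure_def)

lemma vnorm_diff_Lp_space:
  assumes [measurable]: "f \<in> borel_measurable M" "g \<in> borel_measurable M"
  shows "vnorm (Lp_space M p) (vadd (Lp_space M p) (ae_class M f) (vscale (Lp_space M p) (-1) (ae_class M g)))
    = Lp_integral M p (\<lambda>x. f x - g x) powr (1 / p)"
  by (simp add: vscale_Lp_space vadd_Lp_space vnorm_Lp_space Lp_integral_def)

lemma Lp_functions_of_ae_class:
  assumes "s \<in> borel_measurable M" "ae_class M s \<in> carrier (Lp_space M p)"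
  shows "s \<in> Lp_functions M p"
proof -
  note [measurable] = assms(1)
  obtain g where g: "g \<in> Lp_functions M p" "ae_class M s = ae_class M g"
    using assms(2) by (auto simp: Lp_space_def)
  have "s \<in> ae_class M s" by (simp add: ae_class_def)
  then have "AE x in M. s x = g x" by (simp add: g(2)) (simp add: ae_class_def)
  then have "AE x in M. cmod (g x) powr p = cmod (s x) powr p" by eventually_elim simp
  then have "integrable M (\<lambda>x. cmod (s x) powr p)"
    by (rule integrable_cong_AE_imp[OF Lp_functionsD(2)[OF g(1)], rotated]) simp
  then show ?thesis by (simp add: Lp_functions_def)
qed

lemma vclosure_Lp_space:
  assumes p: "0 < p" and S: "S \<subseteq> borel_measurable M"
  shows "vclosure (Lp_space M p) (ae_class M ` S) = ae_class M ` Lp_closure M p S"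
proof (intro equalityI subsetI)
  fix A assume A: "A \<in> vclosure (Lp_space M p) (ae_class M ` S)"
  then obtain f where f: "f \<in> Lp_functions M p" "A = ae_class M f"
    by (auto simp: vclosure_def Lp_space_def)
  have "\<exists>s\<in>S \<inter> Lp_functions M p. Lp_integral M p (\<lambda>x. f x - s x) < \<epsilon>" if "0 < \<epsilon>" for \<epsilon>
  proof -
    \<comment> \<open>\<open>vnorm\<close> is the p-th root of \<open>Lp_integral\<close>, so a
      tolerance \<epsilon> for the integral is \<open>\<epsilon> powr (1 / p)\<close> for the norm;
      the converse inclusion uses \<open>\<epsilon> powr p\<close>.\<close>
    have "0 < \<epsilon> powr (1 / p)" using that by simp
    then obtain s where s: "s \<in> S" "ae_class M s \<in> carrier (Lp_space M p)"
      "vnorm (Lp_space M p) (vadd (Lp_space M p) A (vscale (Lp_space M p) (-1) (ae_class M s))) < \<epsilon> powr (1 / p)"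
      using A unfolding vclosure_def by blast
    then have "Lp_integral M p (\<lambda>x. f x - s x) powr (1 / p) < \<epsilon> powr (1 / p)"
      using S f vnorm_diff_Lp_space[OF Lp_functionsD(1)[OF f(1)], of s p] by auto
    then have "Lp_integral M p (\<lambda>x. f x - s x) < \<epsilon>"
      using p that powr_mono2[of "1 / p" \<epsilon> "Lp_integral M p (\<lambda>x. f x - s x)"] by force
    then show ?thesis using s S Lp_functions_of_ae_class by blast
  qed
  then show "A \<in> ae_class M ` Lp_closure M p S" using f by (auto simp: Lp_closure_def)
next
  fix A assume "A \<in> ae_class M ` Lp_closure M p S"
  then obtain f where f: "f \<in> Lp_closure M p S" "A = ae_class M f" by auto
  have "\<exists>s\<in>ae_class M ` S \<inter> carrier (Lp_space M p).
      vnorm (Lp_space M p) (vadd (Lp_space M p) A (vscale (Lp_space M p) (-1) s)) < \<epsilon>" if \<epsilon>: "0 < \<epsilon>" for \<epsilon>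
  proof -
    obtain s where s: "s \<in> S" "s \<in> Lp_functions M p" "Lp_integral M p (\<lambda>x. f x - s x) < \<epsilon> powr p"
      using Lp_closureD(2)[OF f(1), of "\<epsilon> powr p"] \<epsilon> by auto
    then have "Lp_integral M p (\<lambda>x. f x - s x) powr (1 / p) < (\<epsilon> powr p) powr (1 / p)"
      using p by (intro powr_less_mono2) auto
    then have "vnorm (Lp_space M p) (vadd (Lp_space M p) A (vscale (Lp_space M p) (-1) (ae_class M s))) < \<epsilon>"
      using p \<epsilon> f(2) Lp_functionsD(1)[OF Lp_closureD(1)[OF f(1)]] Lp_functionsD(1)[OF s(2)]
      by (simp add: vnorm_diff_Lp_space powr_powr)
    moreover have "ae_class M s \<in> ae_class M ` S \<inter> carrier (Lp_space M p)"
      using s by (auto simp: Lp_space_def)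
    ultimately show ?thesis by blast
  qed
  moreover have "A \<in> carrier (Lp_space M p)"
    using f(2) Lp_closureD(1)[OF f(1)] by (simp add: Lp_space_def)
  ultimately show "A \<in> vclosure (Lp_space M p) (ae_class M ` S)" by (simp add: vclosure_def)
qed

lemma closed_Lp_subspace_closure:
  assumes p: "1 < p"
    and zero: "(\<lambda>x. 0) \<in> S"
    and add: "\<And>f g. f \<in> S \<Longrightarrow> g \<in> S \<Longrightarrow> (\<lambda>x. f x + g x) \<in> S"
    and scale: "\<And>c f. f \<in> S \<Longrightarrow> (\<lambda>x. c * f x) \<in> S"
  shows "closed_Lp_subspace M p (Lp_closure M p S)"
proof
  \<comment> \<open>The denominator absorbs the factor \<open>2 powr p\<close> of
    \<open>Lp_functions_add\<close> and splits \<epsilon> between two summands.\<close>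
  have sum_less: "Lp_integral M p (\<lambda>x. a x + b x) < \<epsilon>"
    if "a \<in> Lp_functions M p" "b \<in> Lp_functions M p"
      "Lp_integral M p a < \<epsilon> / (2 * 2 powr p)" "Lp_integral M p b < \<epsilon> / (2 * 2 powr p)" for a b \<epsilon>
  proof -
    have "2 powr p * (Lp_integral M p a + Lp_integral M p b)
        < 2 powr p * (\<epsilon> / (2 * 2 powr p) + \<epsilon> / (2 * 2 powr p))"
      using that(3,4) by (intro mult_strict_left_mono add_strict_mono) auto
    also have "\<dots> = \<epsilon>" by simp
    finally show ?thesis using Lp_functions_add(2)[OF p that(1,2)] by linarith
  qed
  show "1 < p" by (rule p)
  show "Lp_closure M p S \<subseteq> Lp_functions M p" using Lp_closureD(1) by blast
  have "(\<lambda>x. 0) \<in> Lp_functions M p" by (simp add: Lp_functions_def)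
  moreover have "Lp_integral M p (\<lambda>x. 0 - 0) < \<epsilon>" if "0 < \<epsilon>" for \<epsilon>
    using that by (simp add: Lp_integral_def)
  ultimately show "(\<lambda>x. 0) \<in> Lp_closure M p S"
    unfolding Lp_closure_def by (intro CollectI conjI allI impI bexI[OF _ IntI[OF zero]])
  show "(\<lambda>x. f x + g x) \<in> Lp_closure M p S"
    if f: "f \<in> Lp_closure M p S" and g: "g \<in> Lp_closure M p S" for f g
    unfolding Lp_closure_def
  proof (intro CollectI conjI allI impI Lp_functions_add(1)[OF p] Lp_closureD(1)[OF f] Lp_closureD(1)[OF g])
    fix \<epsilon> :: real assume "0 < \<epsilon>"
    then have \<epsilon>: "0 < \<epsilon> / (2 * 2 powr p)" by simp
    obtain s t where st: "s \<in> S" "s \<in> Lp_functions M p"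
      "Lp_integral M p (\<lambda>x. f x - s x) < \<epsilon> / (2 * 2 powr p)" "t \<in> S" "t \<in> Lp_functions M p"
      "Lp_integral M p (\<lambda>x. g x - t x) < \<epsilon> / (2 * 2 powr p)"
      using Lp_closureD(2)[OF f \<epsilon>] Lp_closureD(2)[OF g \<epsilon>] by blast
    then have "Lp_integral M p (\<lambda>x. (f x - s x) + (g x - t x)) < \<epsilon>"
      by (intro sum_less Lp_functions_diff p Lp_closureD(1)[OF f] Lp_closureD(1)[OF g])
    then show "\<exists>s\<in>S \<inter> Lp_functions M p. Lp_integral M p (\<lambda>x. f x + g x - s x) < \<epsilon>"
      using st p by (intro bexI[of _ "\<lambda>x. s x + t x"])
        (auto simp: algebra_simps intro: add Lp_functions_add)
  qed
  show "(\<lambda>x. c * f x) \<in> Lp_closure M p S" if f: "f \<in> Lp_closure M p S" for c f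
    unfolding Lp_closure_def
  proof (intro CollectI conjI allI impI Lp_functions_scale(1) Lp_closureD(1)[OF f])
    fix \<epsilon> :: real assume \<epsilon>: "0 < \<epsilon>"
    then obtain s where s: "s \<in> S" "s \<in> Lp_functions M p"
      "Lp_integral M p (\<lambda>x. f x - s x) < \<epsilon> / (cmod c powr p + 1)"
      using Lp_closureD(2)[OF f, of "\<epsilon> / (cmod c powr p + 1)"]
      by (auto simp: add_nonneg_pos)
    have pos: "0 < cmod c powr p + 1" by (rule add_nonneg_pos) auto
    then have "(cmod c powr p + 1) * Lp_integral M p (\<lambda>x. f x - s x) < \<epsilon>"
      using s(3) by (simp add: pos_less_divide_eq mult.commute)
    moreover have "Lp_integral M p (\<lambda>x. c * (f x - s x)) = cmod c powr p * Lp_integral M p (\<lambda>x. f x - s x)"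
      by (intro Lp_functions_scale Lp_functions_diff p Lp_closureD(1)[OF f] s)
    moreover have "cmod c powr p * Lp_integral M p (\<lambda>x. f x - s x)
        \<le> (cmod c powr p + 1) * Lp_integral M p (\<lambda>x. f x - s x)"
      by (intro mult_right_mono) auto
    ultimately have "Lp_integral M p (\<lambda>x. c * (f x - s x)) < \<epsilon>" by linarith
    then show "\<exists>s\<in>S \<inter> Lp_functions M p. Lp_integral M p (\<lambda>x. c * f x - s x) < \<epsilon>"
      using s by (intro bexI[of _ "\<lambda>x. c * s x"])
        (auto simp: right_diff_distrib intro: scale Lp_functions_scale)
  qed
  show "f \<in> Lp_closure M p S"
    if f: "f \<in> Lp_functions M p"
      and approx: "\<And>\<epsilon>. 0 < \<epsilon> \<Longrightarrow> \<exists>s\<in>Lp_closure M p S. Lp_integral M p (\<lambda>x. f x - s x) < \<epsilon>" for f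
    unfolding Lp_closure_def
  proof (intro CollectI conjI allI impI f)
    fix \<epsilon> :: real assume "0 < \<epsilon>"
    then have \<epsilon>: "0 < \<epsilon> / (2 * 2 powr p)" by simp
    then obtain s where s: "s \<in> Lp_closure M p S" "Lp_integral M p (\<lambda>x. f x - s x) < \<epsilon> / (2 * 2 powr p)"
      using approx by blast
    obtain t where t: "t \<in> S" "t \<in> Lp_functions M p" "Lp_integral M p (\<lambda>x. s x - t x) < \<epsilon> / (2 * 2 powr p)"
      using Lp_closureD(2)[OF s(1) \<epsilon>] by auto
    have "Lp_integral M p (\<lambda>x. (f x - s x) + (s x - t x)) < \<epsilon>"
      by (intro sum_less Lp_functions_diff p f Lp_closureD(1)[OF s(1)] s t)
    then show "\<exists>s\<in>S \<inter> Lp_functions M p. Lp_integral M p (\<lambda>x. f x - s x) < \<epsilon>"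
      using t by (intro bexI[of _ t]) auto
  qed
qed

text \<open>The approximants are mapped along with \<open>f\<close>: they stay in \<open>S\<close>,
  and they become q-integrable because the q-th power of |mazur s| is |s|^p.\<close>

lemma mazur_Lp_closure:
  assumes p: "1 < p" and pq: "1 / p + 1 / q = 1"
    and S: "\<And>f. f \<in> S \<Longrightarrow> (\<lambda>x. mazur p (f x)) \<in> S"
    and f: "f \<in> Lp_closure M p S"
  shows "(\<lambda>x. mazur p (f x)) \<in> Lp_closure M q S"
  unfolding Lp_closure_def
proof (intro CollectI conjI allI impI Lp_functions_mazur(1)[OF p pq] Lp_closureD(1)[OF f])
  fix \<epsilon> :: real assume "0 < \<epsilon>"
  then obtain \<delta> where \<delta>: "0 < \<delta>"
    "\<And>g. g \<in> Lp_functions M p \<Longrightarrow> Lp_integral M p (\<lambda>x. f x - g x) < \<delta> \<Longrightarrow>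
       Lp_integral M q (\<lambda>x. mazur p (f x) - mazur p (g x)) < \<epsilon>"
    using Lp_mazur_continuous[OF p pq _ Lp_closureD(1)[OF f]] by metis
  obtain s where s: "s \<in> S" "s \<in> Lp_functions M p" "Lp_integral M p (\<lambda>x. f x - s x) < \<delta>"
    using Lp_closureD(2)[OF f \<delta>(1)] by auto
  then show "\<exists>s\<in>S \<inter> Lp_functions M q. Lp_integral M q (\<lambda>x. mazur p (f x) - s x) < \<epsilon>"
    using S \<delta>(2) Lp_functions_mazur(1)[OF p pq]
    by (intro bexI[of _ "\<lambda>x. mazur p (s x)"]) auto
qed

section \<open>Duality between two closed subspaces exchanged by the Mazur maps\<close>

definition Lp_subspace :: "'a measure \<Rightarrow> real \<Rightarrow> ('a \<Rightarrow> complex) set \<Rightarrow> ('a \<Rightarrow> complex) set complex_normed"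
  where "Lp_subspace M p Y = Lp_space M p \<lparr>carrier := ae_class M ` Y\<rparr>"

lemma Lp_subspace_simps:
  "carrier (Lp_subspace M p Y) = ae_class M ` Y"
  "f \<in> borel_measurable M \<Longrightarrow> g \<in> borel_measurable M \<Longrightarrow>
    vadd (Lp_subspace M p Y) (ae_class M f) (ae_class M g) = ae_class M (\<lambda>x. f x + g x)"
  "f \<in> borel_measurable M \<Longrightarrow> vscale (Lp_subspace M p Y) c (ae_class M f) = ae_class M (\<lambda>x. c * f x)"
  "f \<in> borel_measurable M \<Longrightarrow>
    vnorm (Lp_subspace M p Y) (ae_class M f) = Lp_integral M p f powr (1 / p)"
  using vadd_Lp_space[of f M g p] vscale_Lp_space[of f M p c] vnorm_Lp_space[of f M p]
  by (simp_all add: Lp_subspace_def Lp_integral_def)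

lemma mazur_mult_cnj: "mazur q z * cnj z = complex_of_real (cmod z powr q)"
  using arg_cong[OF mult_cnj_mazur[of z q], of cnj] by (simp add: mult.commute)

text \<open>The Mazur maps provide the extremal functions of the duality in both directions.\<close>

locale Mazur_dual_pair = Y: closed_Lp_subspace M p Y + Z: closed_Lp_subspace M q Z
  for M :: "'a measure" and p q Y Z +
  assumes pq: "1 / p + 1 / q = 1"
    and mazur_Y: "f \<in> Y \<Longrightarrow> (\<lambda>x. mazur p (f x)) \<in> Z"
    and mazur_Z: "g \<in> Z \<Longrightarrow> (\<lambda>x. mazur q (g x)) \<in> Y"
begin

abbreviation "X \<equiv> Lp_subspace M p Y"

abbreviation "dual_map g \<equiv> \<lambda>f\<in>carrier X. Lp_pairing M f g"

lemma qp: "1 / q + 1 / p = 1" using pq by (simp add: add.commute)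

lemma Y_L: "f \<in> Y \<Longrightarrow> f \<in> Lp_functions M p" using Y.subset by auto
lemma Z_L: "g \<in> Z \<Longrightarrow> g \<in> Lp_functions M q" using Z.subset by auto
lemma Y_meas: "f \<in> Y \<Longrightarrow> f \<in> borel_measurable M" using Y_L Lp_functionsD(1) by blast
lemma Z_meas: "g \<in> Z \<Longrightarrow> g \<in> borel_measurable M" using Z_L Lp_functionsD(1) by blast

lemma dual_map_apply:
  assumes "f \<in> Y" "g \<in> Z"
  shows "dual_map (ae_class M g) (ae_class M f) = (LINT x|M. f x * cnj (g x))"
  using assms Y_meas Z_meas by (simp add: Lp_subspace_simps(1) Lp_pairing_ae_class)

lemma pairing_integrable:
  assumes "f \<in> Y" "g \<in> Z"
  shows "integrable M (\<lambda>x. f x * cnj (g x))"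
  by (rule Lp_functions_Holder(1)[OF Y.p pq Y_L[OF assms(1)] Z_L[OF assms(2)]])

lemma pairing_bound:
  assumes "f \<in> Y" "g \<in> Z"
  shows "cmod (LINT x|M. f x * cnj (g x))
    \<le> Lp_integral M p f powr (1 / p) * Lp_integral M q g powr (1 / q)"
  by (rule Lp_functions_Holder(2)[OF Y.p pq Y_L[OF assms(1)] Z_L[OF assms(2)]])

lemma pairing_mazur: "(LINT x|M. mazur q (g x) * cnj (g x)) = complex_of_real (Lp_integral M q g)"
  by (simp only: mazur_mult_cnj Lp_integral_def integral_complex_of_real)

lemma extensional_X_eqI:
  assumes "\<phi> \<in> extensional (carrier X)" "\<psi> \<in> extensional (carrier X)"
    and "\<And>f. f \<in> Y \<Longrightarrow> \<phi> (ae_class M f) = \<psi> (ae_class M f)"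
  shows "\<phi> = \<psi>"
  using assms by (intro extensionalityI[OF assms(1,2)]) (auto simp: Lp_subspace_simps(1))

lemma dual_map_in_dual:
  assumes g: "g \<in> Z"
  shows "dual_map (ae_class M g) \<in> carrier (dual_space X)"
proof -
  have "dual_map (ae_class M g) (vadd X A B) = dual_map (ae_class M g) A + dual_map (ae_class M g) B"
    if AB: "A \<in> carrier X" "B \<in> carrier X" for A B
  proof -
    obtain f h where fh: "f \<in> Y" "h \<in> Y" "A = ae_class M f" "B = ae_class M h"
      using AB by (auto simp: Lp_subspace_simps(1))
    have "vadd X A B = ae_class M (\<lambda>x. f x + h x)"
      using fh Y_meas by (simp add: Lp_subspace_simps)
    then show ?thesis
      using dual_map_apply[OF _ g] fh Y.add[OF fh(1,2)] pairing_integrable[OF _ g]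
      by (simp add: distrib_right del: restrict_apply)
  qed
  moreover have "dual_map (ae_class M g) (vscale X c A) = c * dual_map (ae_class M g) A"
    if A: "A \<in> carrier X" for c A
  proof -
    obtain f where f: "f \<in> Y" "A = ae_class M f"
      using A by (auto simp: Lp_subspace_simps(1))
    have "vscale X c A = ae_class M (\<lambda>x. c * f x)"
      using f Y_meas by (simp add: Lp_subspace_simps)
    then show ?thesis
      using dual_map_apply[OF _ g] f Y.scale[OF f(1)]
      by (simp add: mult.assoc del: restrict_apply)
  qed
  moreover have "cmod (dual_map (ae_class M g) A) \<le> Lp_integral M q g powr (1 / q) * vnorm X A"
    if A: "A \<in> carrier X" for A
  proof -
    obtain f where f: "f \<in> Y" "A = ae_class M f"
      using A by (auto simp: Lp_subspace_simps(1))
    then show ?thesis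
      using dual_map_apply[OF f(1) g] pairing_bound[OF f(1) g] Y_meas
      by (simp add: Lp_subspace_simps(4) mult.commute del: restrict_apply)
  qed
  ultimately show ?thesis
    unfolding dual_space_def partial_object.simps
    by (intro CollectI conjI exI[of _ "Lp_integral M q g powr (1 / q)"] ballI allI restrict_extensional)
qed

lemma vnorm_dual_map:
  assumes g: "g \<in> Z"
  shows "vnorm (dual_space X) (dual_map (ae_class M g)) = Lp_integral M q g powr (1 / q)"
proof -
  define I where "I = Lp_integral M q g"
  have I0: "0 \<le> I" by (simp add: I_def)
  \<comment> \<open>The p-th power of \<open>mazur q (g x)\<close> has integral \<open>I\<close>, so
    this factor normalizes it; the pairing with \<open>g\<close> becomes I^(1 - 1/p) = I^(1/q), the
    Hoelder bound.\<close>
  define f where "f x = complex_of_real (I powr (- 1 / p)) * mazur q (g x)" for x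
  have f: "f \<in> Y" unfolding f_def by (intro Y.scale mazur_Z g)
  have "Lp_integral M p f = (I powr (- 1 / p)) powr p * I"
    using Lp_functions_scale(2)[OF Y_L[OF mazur_Z[OF g]]]
      Lp_functions_mazur(2)[OF Z.p qp Z_L[OF g]] by (simp add: f_def[abs_def] I_def)
  also have "(I powr (- 1 / p)) powr p = I powr - 1" using Y.p by (simp add: powr_powr)
  \<comment> \<open>An inequality rather than an equation covers \<open>I = 0\<close>, where the
    product is 0.\<close>
  also have "I powr - 1 * I \<le> 1" using I0 by (cases "I = 0") (auto simp: powr_minus)
  finally have f1: "Lp_integral M p f powr (1 / p) \<le> 1"
    using Y.p powr_mono2[of "1 / p" "Lp_integral M p f" 1] by simp
  have "(LINT x|M. f x * cnj (g x)) = complex_of_real (I powr (- 1 / p)) * complex_of_real I"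
    by (simp add: f_def mult.assoc pairing_mazur I_def)
  then have "cmod (LINT x|M. f x * cnj (g x)) = I * I powr (- 1 / p)"
    using I0 by (simp add: norm_mult)
  also have "\<dots> = I powr (1 + - 1 / p)" by (rule powr_mult_base[OF I0])
  also have "1 + - 1 / p = 1 / q" using pq by (simp only: minus_divide_left[symmetric])
  finally have val: "cmod (dual_map (ae_class M g) (ae_class M f)) = I powr (1 / q)"
    using dual_map_apply[OF f g] by simp
  have "(SUP A\<in>{A \<in> carrier X. vnorm X A \<le> 1}. cmod (dual_map (ae_class M g) A)) = I powr (1 / q)"
  proof (rule cSup_eq_maximum)
    have "ae_class M f \<in> {A \<in> carrier X. vnorm X A \<le> 1}"
      using f f1 Y_meas by (simp add: Lp_subspace_simps)
    then show "I powr (1 / q) \<in> (\<lambda>A. cmod (dual_map (ae_class M g) A)) ` {A \<in> carrier X. vnorm X A \<le> 1}"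
      using val by (metis (no_types, lifting) image_eqI)
    fix y assume "y \<in> (\<lambda>A. cmod (dual_map (ae_class M g) A)) ` {A \<in> carrier X. vnorm X A \<le> 1}"
    then obtain h where h: "h \<in> Y" "vnorm X (ae_class M h) \<le> 1" "y = cmod (dual_map (ae_class M g) (ae_class M h))"
      by (auto simp: Lp_subspace_simps(1))
    then have "y \<le> Lp_integral M p h powr (1 / p) * I powr (1 / q)"
      using dual_map_apply[OF h(1) g] pairing_bound[OF h(1) g] by (simp add: I_def)
    also have "\<dots> \<le> 1 * I powr (1 / q)"
      using h(1,2) Y_meas by (intro mult_right_mono) (auto simp: Lp_subspace_simps)
    finally show "y \<le> I powr (1 / q)" by simp
  qed
  then show ?thesis by (simp add: dual_space_def I_def)
qed

text \<open>The difference \<open>d\<close> of the two functions lies in \<open>Z\<close> and cannot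
  be paired with itself, but \<open>mazur q d\<close> lies in \<open>Y\<close>, and its pairing with
  \<open>d\<close> is the integral of |d|^q.\<close>

lemma dual_map_eq_iff:
  assumes g: "g \<in> Z" and h: "h \<in> Z" and eq: "dual_map (ae_class M g) = dual_map (ae_class M h)"
  shows "ae_class M g = ae_class M h"
proof -
  define d where "d x = g x + -1 * h x" for x
  have d: "d \<in> Z" unfolding d_def by (intro Z.add Z.scale g h)
  note f = mazur_Z[OF d]
  have "(LINT x|M. mazur q (d x) * cnj (d x))
      = (LINT x|M. mazur q (d x) * cnj (g x) - mazur q (d x) * cnj (h x))"
    by (simp add: d_def right_diff_distrib)
  also have "\<dots> = 0"
    using fun_cong[OF eq, of "ae_class M (\<lambda>x. mazur q (d x))"] dual_map_apply[OF f g] dual_map_apply[OF f h]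
      pairing_integrable[OF f g] pairing_integrable[OF f h] by simp
  finally have "Lp_integral M q d = 0" by (simp add: pairing_mazur)
  then have "AE x in M. d x = 0" by (rule Lp_integral_eq_0D[OF Z_L[OF d]])
  then show ?thesis by (intro ae_class_cong) (simp add: d_def)
qed

lemma dual_map_surj:
  assumes \<phi>: "\<phi> \<in> carrier (dual_space X)"
  obtains g where "g \<in> Z" "\<phi> = dual_map (ae_class M g)"
proof -
  have ext: "\<phi> \<in> extensional (carrier X)"
    and \<phi>_add: "\<And>A B. A \<in> carrier X \<Longrightarrow> B \<in> carrier X \<Longrightarrow> \<phi> (vadd X A B) = \<phi> A + \<phi> B"
    and \<phi>_scale: "\<And>c A. A \<in> carrier X \<Longrightarrow> \<phi> (vscale X c A) = c * \<phi> A"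
    using \<phi> by (auto simp: dual_space_def)
  have "\<exists>C. \<forall>A\<in>carrier X. cmod (\<phi> A) \<le> C * vnorm X A"
    using \<phi> by (simp add: dual_space_def)
  then obtain C where C: "\<And>A. A \<in> carrier X \<Longrightarrow> cmod (\<phi> A) \<le> C * vnorm X A"
    by blast
  \<comment> \<open>Composing \<phi> with \<open>ae_class\<close> gives a functional on functions
    that respects a.e. equality automatically.\<close>
  interpret F: bounded_Lp_functional M p Y "\<lambda>f. \<phi> (ae_class M f)" C
  proof
    show "\<phi> (ae_class M (\<lambda>x. f x + g x)) = \<phi> (ae_class M f) + \<phi> (ae_class M g)"
      if "f \<in> Y" "g \<in> Y" for f g
      using \<phi>_add[of "ae_class M f" "ae_class M g"] that Y_meas by (simp add: Lp_subspace_simps)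
    show "\<phi> (ae_class M (\<lambda>x. c * f x)) = c * \<phi> (ae_class M f)" if "f \<in> Y" for c f
      using \<phi>_scale[of "ae_class M f" c] that Y_meas by (simp add: Lp_subspace_simps)
    show "cmod (\<phi> (ae_class M f)) \<le> C * Lp_integral M p f powr (1 / p)" if "f \<in> Y" for f
      using C[of "ae_class M f"] that Y_meas by (simp add: Lp_subspace_simps)
  qed
  obtain u c where u: "u \<in> Y"
    "\<And>f. f \<in> Y \<Longrightarrow> \<phi> (ae_class M f) = (LINT x|M. f x * cnj (c * mazur p (u x)))"
    using F.represented[OF pq] by blast
  have g: "(\<lambda>x. c * mazur p (u x)) \<in> Z" by (intro Z.scale mazur_Y u)
  show ?thesis
  proof (rule that[OF g], rule extensional_X_eqI[OF ext])
    show "\<phi> (ae_class M f) = dual_map (ae_class M (\<lambda>x. c * mazur p (u x))) (ae_class M f)"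
      if "f \<in> Y" for f
      unfolding dual_map_apply[OF that g] by (rule u(2)[OF that])
  qed simp
qed

theorem conj_isometric_iso_dual_map: "conj_isometric_iso (Lp_subspace M q Z) (dual_space X) dual_map"
  unfolding conj_isometric_iso_def
proof (intro conjI ballI allI)
  show "bij_betw dual_map (carrier (Lp_subspace M q Z)) (carrier (dual_space X))"
    unfolding bij_betw_def
  proof (intro conjI equalityI subsetI)
    show "inj_on dual_map (carrier (Lp_subspace M q Z))"
      using dual_map_eq_iff by (intro inj_onI) (auto simp only: Lp_subspace_simps(1))
    show "\<phi> \<in> carrier (dual_space X)" if "\<phi> \<in> dual_map ` carrier (Lp_subspace M q Z)" for \<phi>
      using that dual_map_in_dual by (auto simp only: Lp_subspace_simps(1))
    show "\<phi> \<in> dual_map ` carrier (Lp_subspace M q Z)" if "\<phi> \<in> carrier (dual_space X)" for \<phi>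
      using dual_map_surj[OF that] by (metis Lp_subspace_simps(1) image_eqI)
  qed
next
  fix A B assume "A \<in> carrier (Lp_subspace M q Z)" "B \<in> carrier (Lp_subspace M q Z)"
  then obtain g h where gh: "g \<in> Z" "h \<in> Z" "A = ae_class M g" "B = ae_class M h"
    by (auto simp: Lp_subspace_simps(1))
  have AB: "vadd (Lp_subspace M q Z) A B = ae_class M (\<lambda>x. g x + h x)"
    using gh Z_meas by (simp add: Lp_subspace_simps)
  have "dual_map (ae_class M (\<lambda>x. g x + h x)) (ae_class M f)
      = dual_map A (ae_class M f) + dual_map B (ae_class M f)" if "f \<in> Y" for f
    unfolding gh(3,4) dual_map_apply[OF that gh(1)] dual_map_apply[OF that gh(2)]
      dual_map_apply[OF that Z.add[OF gh(1,2)]]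
    using pairing_integrable[OF that gh(1)] pairing_integrable[OF that gh(2)]
    by (simp add: distrib_left)
  then show "dual_map (vadd (Lp_subspace M q Z) A B) = vadd (dual_space X) (dual_map A) (dual_map B)"
    unfolding AB by (intro extensional_X_eqI) (auto simp: dual_space_def Lp_subspace_simps(1))
next
  fix c A assume "A \<in> carrier (Lp_subspace M q Z)"
  then obtain g where g: "g \<in> Z" "A = ae_class M g"
    by (auto simp: Lp_subspace_simps(1))
  have cA: "vscale (Lp_subspace M q Z) c A = ae_class M (\<lambda>x. c * g x)"
    using g Z_meas by (simp add: Lp_subspace_simps)
  have "dual_map (ae_class M (\<lambda>x. c * g x)) (ae_class M f) = cnj c * dual_map A (ae_class M f)"
    if "f \<in> Y" for f
    unfolding g(2) dual_map_apply[OF that g(1)] dual_map_apply[OF that Z.scale[OF g(1)]]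
    by (simp add: mult.left_commute)
  then show "dual_map (vscale (Lp_subspace M q Z) c A) = vscale (dual_space X) (cnj c) (dual_map A)"
    unfolding cA by (intro extensional_X_eqI) (auto simp: dual_space_def Lp_subspace_simps(1))
next
  fix A assume "A \<in> carrier (Lp_subspace M q Z)"
  then obtain g where g: "g \<in> Z" "A = ae_class M g"
    by (auto simp: Lp_subspace_simps(1))
  then show "vnorm (dual_space X) (dual_map A) = vnorm (Lp_subspace M q Z) A"
    using vnorm_dual_map[OF g(1)] Z_meas[OF g(1)] by (simp add: Lp_subspace_simps(4))
qed

end

section \<open>Covariant functions with compact support modulo the subgroup\<close>

lemma (in topological_group) continuous_map_right_mult:
  assumes "h \<in> carrier G"
  shows "continuous_map T T (\<lambda>x. x \<otimes> h)"
proof -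
  have "continuous_map T (prod_topology T T) (\<lambda>x. (x, h))"
    using assms topspace_eq_carrier by (auto simp: continuous_map_pairwise o_def)
  from continuous_map_compose[OF this continuous_mult] show ?thesis by (simp add: o_def)
qed

locale covariance = topological_group G T for G :: "('a, 'b) monoid_scheme" (structure) and T +
  fixes H :: "'a set" and \<xi> :: "'a \<Rightarrow> complex"
  assumes subgroup: "subgroup H G"
    and cmod_\<xi>: "h \<in> H \<Longrightarrow> cmod (\<xi> h) = 1"
begin

lemma M_cov_iff:
  "\<psi> \<in> M_cov G T H \<xi> \<longleftrightarrow> continuous_map T euclidean \<psi> \<and>
    compactin (coset_topology G T H) ((\<lambda>x. x <#\<^bsub>G\<^esub> H) ` support_on T \<psi>) \<and>
    (\<forall>x\<in>carrier G. \<forall>h\<in>H. \<psi> (x \<otimes> h) = \<xi> h * \<psi> x)"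
  by (simp add: M_cov_def C_c_mod_def)

text \<open>Covariance with |\<xi>| = 1 makes the nonvanishing set invariant under right translation
  by \<open>H\<close>, and continuity passes this to its closure. So the support is the full
  preimage of its image, and a quotient map sends saturated closed sets to closed sets.\<close>

lemma closedin_image_support:
  assumes cov: "\<And>x h. x \<in> carrier G \<Longrightarrow> h \<in> H \<Longrightarrow> \<psi> (x \<otimes> h) = \<xi> h * \<psi> x"
  shows "closedin (coset_topology G T H) ((\<lambda>x. x <#\<^bsub>G\<^esub> H) ` support_on T \<psi>)"
proof -
  let ?A = "{x \<in> topspace T. \<psi> x \<noteq> 0}" and ?q = "\<lambda>x. x <#\<^bsub>G\<^esub> H"
  have HG: "H \<subseteq> carrier G" by (rule subgroup.subset[OF subgroup])
  have supp: "support_on T \<psi> \<subseteq> topspace T" by (simp add: support_on_def closure_of_subset_topspace)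
  have "x \<otimes> h \<in> support_on T \<psi>" if x: "x \<in> support_on T \<psi>" and h: "h \<in> H" for x h
  proof -
    have hG: "h \<in> carrier G" using h HG by auto
    have "(\<lambda>x. x \<otimes> h) ` ?A \<subseteq> ?A"
      using cov[OF _ h] cmod_\<xi>[OF h] hG by (auto simp: topspace_eq_carrier)
    then have "T closure_of (\<lambda>x. x \<otimes> h) ` ?A \<subseteq> T closure_of ?A" by (rule closure_of_mono)
    then show ?thesis
      using x continuous_map_image_closure_subset[OF continuous_map_right_mult[OF hG], of ?A]
      unfolding support_on_def by blast
  qed
  then have "{x \<in> topspace T. ?q x \<in> ?q ` support_on T \<psi>} \<subseteq> support_on T \<psi>"
  proof (intro subsetI)
    fix x assume "x \<in> {x \<in> topspace T. ?q x \<in> ?q ` support_on T \<psi>}"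
    then obtain y where x: "x \<in> carrier G" and y: "y \<in> support_on T \<psi>" "x <#\<^bsub>G\<^esub> H = y <#\<^bsub>G\<^esub> H"
      by (auto simp: topspace_eq_carrier)
    \<comment> \<open>Equal cosets are turned into \<open>x = y \<otimes> h\<close> by looking at
      the element \<open>x \<otimes> \<one>\<close> of the first one.\<close>
    have "x \<otimes> \<one> \<in> x <#\<^bsub>G\<^esub> H" using subgroup.one_closed[OF subgroup] by (auto simp: l_coset_def)
    then obtain h where "h \<in> H" "x = y \<otimes> h" using x y(2) by (auto simp: l_coset_def)
    then show "x \<in> support_on T \<psi>"
      using \<open>\<And>x h. x \<in> support_on T \<psi> \<Longrightarrow> h \<in> H \<Longrightarrow> x \<otimes> h \<in> support_on T \<psi>\<close> y(1) by simp
  qed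
  then have "{x \<in> topspace T. ?q x \<in> ?q ` support_on T \<psi>} = support_on T \<psi>" using supp by auto
  moreover have "closedin T (support_on T \<psi>)" by (simp add: support_on_def)
  moreover have "?q ` support_on T \<psi> \<subseteq> topspace (coset_topology G T H)"
    using supp quotient_map_coset_topology[of H] unfolding quotient_map_def by blast
  ultimately show ?thesis
    using quotient_map_coset_topology[of H] unfolding quotient_map_closedin by metis
qed

text \<open>A subset of a compact set inherits compactness here only because the image of the
  support is closed, which covariance provides. Two dominating functions are allowed in order to
  treat sums; for a single one \<open>\<psi>1\<close> and \<open>\<psi>2\<close> coincide.\<close>

lemma M_covI:
  assumes cont: "continuous_map T euclidean \<psi>"
    and cov: "\<And>x h. x \<in> carrier G \<Longrightarrow> h \<in> H \<Longrightarrow> \<psi> (x \<otimes> h) = \<xi> h * \<psi> x"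
    and M: "\<psi>1 \<in> M_cov G T H \<xi>" "\<psi>2 \<in> M_cov G T H \<xi>"
    and supp: "\<And>x. \<psi>1 x = 0 \<Longrightarrow> \<psi>2 x = 0 \<Longrightarrow> \<psi> x = 0"
  shows "\<psi> \<in> M_cov G T H \<xi>"
proof -
  have "support_on T \<psi> \<subseteq> T closure_of ({x \<in> topspace T. \<psi>1 x \<noteq> 0} \<union> {x \<in> topspace T. \<psi>2 x \<noteq> 0})"
    unfolding support_on_def using supp by (intro closure_of_mono) auto
  then have "support_on T \<psi> \<subseteq> support_on T \<psi>1 \<union> support_on T \<psi>2"
    by (simp add: support_on_def)
  then have "(\<lambda>x. x <#\<^bsub>G\<^esub> H) ` support_on T \<psi>
      \<subseteq> (\<lambda>x. x <#\<^bsub>G\<^esub> H) ` support_on T \<psi>1 \<union> (\<lambda>x. x <#\<^bsub>G\<^esub> H) ` support_on T \<psi>2" by blast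
  moreover have "compactin (coset_topology G T H)
      ((\<lambda>x. x <#\<^bsub>G\<^esub> H) ` support_on T \<psi>1 \<union> (\<lambda>x. x <#\<^bsub>G\<^esub> H) ` support_on T \<psi>2)"
    using M by (intro compactin_Un) (auto simp: M_cov_iff)
  ultimately have "compactin (coset_topology G T H) ((\<lambda>x. x <#\<^bsub>G\<^esub> H) ` support_on T \<psi>)"
    using closedin_image_support[OF cov] closed_compactin by blast
  then show ?thesis using cont cov by (simp add: M_cov_iff)
qed

lemma zero_in_M_cov: "(\<lambda>x. 0) \<in> M_cov G T H \<xi>"
  by (simp add: M_cov_iff support_on_def)

lemma add_in_M_cov:
  assumes "\<psi>1 \<in> M_cov G T H \<xi>" "\<psi>2 \<in> M_cov G T H \<xi>"
  shows "(\<lambda>x. \<psi>1 x + \<psi>2 x) \<in> M_cov G T H \<xi>"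
  using assms
  by (intro M_covI[OF _ _ assms] continuous_map_add) (auto simp: M_cov_iff distrib_left)

text \<open>\<open>\<Theta> 0 = 0\<close> controls the support and equivariance under the unit
  circle keeps the covariance, so scalar multiplication and the Mazur map are handled
  together.\<close>

lemma compose_in_M_cov:
  assumes \<psi>: "\<psi> \<in> M_cov G T H \<xi>" and cont: "continuous_on UNIV \<Theta>" and "\<Theta> 0 = 0"
    and \<Theta>: "\<And>w z. cmod w = 1 \<Longrightarrow> \<Theta> (w * z) = w * \<Theta> z"
  shows "(\<lambda>x. \<Theta> (\<psi> x)) \<in> M_cov G T H \<xi>"
proof (rule M_covI[OF _ _ \<psi> \<psi>])
  have "continuous_map T euclidean (\<Theta> \<circ> \<psi>)"
    using \<psi> cont by (intro continuous_map_compose[where X' = euclidean]) (auto simp: M_cov_iff)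
  then show "continuous_map T euclidean (\<lambda>x. \<Theta> (\<psi> x))" by (simp add: o_def)
  show "\<Theta> (\<psi> (x \<otimes> h)) = \<xi> h * \<Theta> (\<psi> x)" if "x \<in> carrier G" "h \<in> H" for x h
    using \<psi> that \<Theta>[OF cmod_\<xi>] by (simp add: M_cov_iff)
qed (use \<open>\<Theta> 0 = 0\<close> in simp)

lemma scale_in_M_cov: "\<psi> \<in> M_cov G T H \<xi> \<Longrightarrow> (\<lambda>x. c * \<psi> x) \<in> M_cov G T H \<xi>"
  by (erule compose_in_M_cov) (auto intro!: continuous_intros)

lemma mazur_in_M_cov:
  assumes "1 < p" "\<psi> \<in> M_cov G T H \<xi>"
  shows "(\<lambda>x. mazur p (\<psi> x)) \<in> M_cov G T H \<xi>"
  by (rule compose_in_M_cov[OF assms(2) continuous_on_mazur[OF assms(1)]])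
    (simp_all add: mazur_mult_unit)

lemma M_cov_borel_measurable:
  assumes "space M = carrier G" "sets M = sigma_sets (carrier G) {U. openin T U}"
  shows "M_cov G T H \<xi> \<subseteq> borel_measurable M"
proof
  fix \<psi> assume "\<psi> \<in> M_cov G T H \<xi>"
  then have cont: "continuous_map T euclidean \<psi>" by (simp add: M_cov_iff)
  show "\<psi> \<in> borel_measurable M"
  proof (rule borel_measurableI)
    fix U :: "complex set" assume "open U"
    then have "openin euclidean U" by simp
    then have "openin T {x \<in> topspace T. \<psi> x \<in> U}"
      by (rule openin_continuous_map_preimage[OF cont])
    moreover have "\<psi> -` U \<inter> space M = {x \<in> topspace T. \<psi> x \<in> U}"
      by (auto simp: assms(1) topspace_eq_carrier)
    ultimately show "\<psi> -` U \<inter> space M \<in> sets M" unfolding assms(2) by auto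
  qed
qed

end

theorem theorem4p12:
  fixes G :: "('a, 'b) monoid_scheme" (structure)
    and T :: "'a topology" and M :: "'a measure"
    and H :: "'a set" and \<xi> :: "'a \<Rightarrow> complex" and p q :: real
  assumes "locally_compact_group G T"
    and "left_haar_measure G T M"
    and "subgroup H G" and "compactin T H"
    and "character_on G T H \<xi>"
    and "1 < p" and "1 < q" and "1 / p + 1 / q = 1"
  shows "conj_isometric_iso (L_cov G T M H \<xi> q) (dual_space (L_cov G T M H \<xi> p))
           (\<lambda>g. \<lambda>f\<in>carrier (L_cov G T M H \<xi> p). Lp_pairing M f g)"
proof -
  interpret covariance G T H \<xi>
    using assms(1,3,5)
    by (intro covariance.intro covariance_axioms.intro)
      (auto simp: locally_compact_group_def character_on_def)
  let ?S = "M_cov G T H \<xi>"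
  have S: "?S \<subseteq> borel_measurable M"
    using assms(2) by (intro M_cov_borel_measurable) (auto simp: left_haar_measure_def)
  have closed: "closed_Lp_subspace M r (Lp_closure M r ?S)" if "1 < r" for r
    using that by (intro closed_Lp_subspace_closure zero_in_M_cov add_in_M_cov scale_in_M_cov)
  \<comment> \<open>Rewriting \<open>vclosure\<close> through closures of functions puts both spaces
    of the statement in the form treated by \<open>Mazur_dual_pair\<close>.\<close>
  have L: "L_cov G T M H \<xi> r = Lp_subspace M r (Lp_closure M r ?S)" if "1 < r" for r
    using that S by (simp add: L_cov_def Lp_subspace_def vclosure_Lp_space)
  have qp: "1 / q + 1 / p = 1" using assms(8) by simp
  \<comment> \<open>\<open>mazur_Lp_closure\<close> is needed in both directions, with the exponents
    exchanged; this is the purpose of \<open>qp\<close>.\<close>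
  interpret Mazur_dual_pair M p q "Lp_closure M p ?S" "Lp_closure M q ?S"
    using assms(6-8) qp
    by (intro Mazur_dual_pair.intro Mazur_dual_pair_axioms.intro closed mazur_Lp_closure mazur_in_M_cov)
  show ?thesis using conj_isometric_iso_dual_map by (simp only: L[OF assms(6)] L[OF assms(7)])
qed

end
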